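(* Let $V$ be a reflexive Banach space and $1<p<\infty$. A function $g\in L^p_b(\mathbb R,V)$ is both space regular and time regular if and only if it is translation compact.
   Context: $L^p_b(\mathbb R,V)$ is the space of $g\in L^p_{loc}(\mathbb R,V)$ with $\|g\|_{L^p_b}:=\sup_{s\in\mathbb R}\|g\|_{L^p((s,s+1),V)}<\infty$. $g$ is translation compact if the orbit $\{g(\cdot+s):s\in\mathbb R\}$ is precompact in the Fréchet space $L^p_{loc}(\mathbb R,V)$. $g$ is space regular if for every $\varepsilon>0$ there are a finite-dimensional subspace $V_\varepsilon\subset V$ and $g_\varepsilon\in L^p_b(\mathbb R,V_\varepsilon)$ with $\|g-g_\varepsilon\|_{L^p_b(\mathbb R,V)}\le\varepsilon$. $g$ is time regular if for every $\varepsilon>0$ there is $g_\varepsilon$ belonging to $C^k_b(\mathbb R,V)$ for all $k$ with $\|g-g_\varepsilon\|_{L^p_b(\mathbb R,V)}\le\varepsilon$. *)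

theory Defs
  imports "HOL-Analysis.Analysis"
begin

definition reflexive_space :: "'v::banach itself \<Rightarrow> bool" where
  "reflexive_space _ \<longleftrightarrow>
     (\<forall>\<psi> :: ('v \<Rightarrow>\<^sub>L real) \<Rightarrow>\<^sub>L real. \<exists>x::'v. \<forall>\<phi>. blinfun_apply \<psi> \<phi> = blinfun_apply \<phi> x)"

definition strongly_measurable :: "(real \<Rightarrow> 'v::real_normed_vector) \<Rightarrow> bool" where
  "strongly_measurable g \<longleftrightarrow>
     (\<exists>F :: nat \<Rightarrow> real \<Rightarrow> 'v.
        (\<forall>n. finite (range (F n)) \<and> (\<forall>x. F n -` {x} \<in> sets lebesgue)) \<and>
        (AE t in lebesgue. (\<lambda>n. F n t) \<longlonglongrightarrow> g t))"

definition lp_int :: "real \<Rightarrow> (real \<Rightarrow> 'v::real_normed_vector) \<Rightarrow> real \<Rightarrow> real \<Rightarrow> ennreal" where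
  "lp_int p g a b = (\<integral>\<^sup>+ t\<in>{a<..<b}. ennreal (norm (g t) powr p) \<partial>lebesgue)"

definition lp_norm_on :: "real \<Rightarrow> (real \<Rightarrow> 'v::real_normed_vector) \<Rightarrow> real \<Rightarrow> real \<Rightarrow> ennreal" where
  "lp_norm_on p g a b =
     (if lp_int p g a b = \<infinity> then \<infinity> else ennreal ((enn2real (lp_int p g a b)) powr (1 / p)))"

definition Lp_loc :: "real \<Rightarrow> (real \<Rightarrow> 'v::real_normed_vector) \<Rightarrow> bool" where
  "Lp_loc p g \<longleftrightarrow> strongly_measurable g \<and> (\<forall>a b. lp_int p g a b < \<infinity>)"

definition Lpb_norm :: "real \<Rightarrow> (real \<Rightarrow> 'v::real_normed_vector) \<Rightarrow> ennreal" where
  "Lpb_norm p g = (SUP s. lp_norm_on p g s (s + 1))"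

definition Lp_b :: "real \<Rightarrow> (real \<Rightarrow> 'v::real_normed_vector) \<Rightarrow> bool" where
  "Lp_b p g \<longleftrightarrow> Lp_loc p g \<and> Lpb_norm p g < \<infinity>"

text \<open>Translation compactness: the orbit {g(.+s)} is precompact in the Fr\'echet space
  L^p_loc(R,V), i.e. (metrizable space) every sequence of translates has a subsequence
  converging in L^p_loc to some element of L^p_loc.\<close>
definition translation_compact :: "real \<Rightarrow> (real \<Rightarrow> 'v::real_normed_vector) \<Rightarrow> bool" where
  "translation_compact p g \<longleftrightarrow>
     (\<forall>s :: nat \<Rightarrow> real. \<exists>r h. strict_mono r \<and> Lp_loc p h \<and>
        (\<forall>a b. ((\<lambda>k. lp_int p (\<lambda>t. g (t + s (r k)) - h t) a b) \<longlongrightarrow> 0) sequentially))"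

definition space_regular :: "real \<Rightarrow> (real \<Rightarrow> 'v::real_normed_vector) \<Rightarrow> bool" where
  "space_regular p g \<longleftrightarrow>
     (\<forall>\<epsilon>>0. \<exists>W :: 'v set. \<exists>g\<epsilon>. subspace W \<and> (\<exists>B. finite B \<and> W = span B) \<and>
        Lp_b p g\<epsilon> \<and> (\<forall>t. g\<epsilon> t \<in> W) \<and> Lpb_norm p (\<lambda>t. g t - g\<epsilon> t) \<le> ennreal \<epsilon>)"

definition smooth_bounded :: "(real \<Rightarrow> 'v::real_normed_vector) \<Rightarrow> bool" where
  "smooth_bounded f \<longleftrightarrow>
     (\<exists>D :: nat \<Rightarrow> real \<Rightarrow> 'v. D 0 = f \<and>
        (\<forall>k t. (D k has_vector_derivative D (Suc k) t) (at t)) \<and> (\<forall>k. bounded (range (D k))))"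

definition time_regular :: "real \<Rightarrow> (real \<Rightarrow> 'v::real_normed_vector) \<Rightarrow> bool" where
  "time_regular p g \<longleftrightarrow>
     (\<forall>\<epsilon>>0. \<exists>g\<epsilon>. smooth_bounded g\<epsilon> \<and> Lpb_norm p (\<lambda>t. g t - g\<epsilon> t) \<le> ennreal \<epsilon>)"

end

theory Submission
  imports Defs "HOL-Library.Diagonal_Subsequence"
begin

text \<open>
  Given smooth and finite-dimensional approximants of a regular \<open>g\<close>, sample the finite-dimensional
  one once in each cell of a fine grid, at a point where its distance to the smooth one is
  at most about average. As the smooth approximant is Lipschitz, the resulting step functions are
  close to the translates of \<open>g\<close>, and their values lie in a bounded part of a finite-dimensional
  space. Hence on every bounded window the translates have finite nets of simple functions; a diagonal
  sequence is followed by simple functions that converge almost everywhere to the limit.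

  Conversely, a translation compact \<open>g\<close> agrees on each \<open>(n, n + 1)\<close>, up to a small error, with
  one of finitely many translates. Each of these is approximated by a smooth function with compact support in
  \<open>[0, 1]\<close> and finite-dimensional range; gluing the shifted copies gives one function that
  witnesses both regularities.
\<close>

section \<open>Strongly measurable functions\<close>

text \<open>The obstacle in the first direction is that neither approximant suffices alone: the
  smooth one varies little on a short cell, but its values need not lie in a finite-dimensional
  subspace; the other one has such values, but no control in time. Sampling joins the two
  properties: a sampled value lies exactly in the subspace and, up to an average error, is close to
  the smooth function on the whole cell. Both approximations are uniform over unit windows, so mesh
  and list of admissible values can be fixed once for all translates. The nets consist of simple
  functions because the limit must itself be strongly measurable, and the simple functions that lead
  to it are then its witnesses. In the converse direction finiteness is used twice: finitely many
  profiles have one finite spanning set and, for each order of derivative, one bound. Estimates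
  concern integrals of p-th powers without the root; each triangle inequality costs a factor
  \<open>2 powr p\<close>.\<close>

definition lebesgue_simple :: "(real \<Rightarrow> 'v) \<Rightarrow> bool" where
  "lebesgue_simple F \<longleftrightarrow> finite (range F) \<and> (\<forall>x. F -` {x} \<in> sets lebesgue)"

lemma lebesgue_simple_vimage:
  assumes "lebesgue_simple F"
  shows "F -` A \<in> sets lebesgue"
proof -
  have "F -` A = (\<Union>x\<in>A \<inter> range F. F -` {x})" by auto
  moreover have "finite (A \<inter> range F)" using assms by (simp add: lebesgue_simple_def)
  ultimately show ?thesis using assms by (auto simp: lebesgue_simple_def)
qed

lemma lebesgue_simple_measurable_real:
  fixes F :: "real \<Rightarrow> real"
  assumes "lebesgue_simple F"
  shows "F \<in> borel_measurable lebesgue"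
  by (rule measurableI) (auto intro: lebesgue_simple_vimage[OF assms])

lemma lebesgue_simple_Pair:
  assumes F: "lebesgue_simple F" and G: "lebesgue_simple G"
  shows "lebesgue_simple (\<lambda>t. (F t, G t))"
proof -
  have "range (\<lambda>t. (F t, G t)) \<subseteq> range F \<times> range G" by auto
  then have "finite (range (\<lambda>t. (F t, G t)))"
    using F G by (meson finite_SigmaI finite_subset lebesgue_simple_def)
  moreover have "(\<lambda>t. (F t, G t)) -` {x} = F -` {fst x} \<inter> G -` {snd x}" for x
    by (cases x) auto
  ultimately show ?thesis using F G by (auto simp: lebesgue_simple_def intro!: sets.Int)
qed

text \<open>Any \<open>h\<close> is admissible, since finite range makes the preimage of every set
  of values measurable. The value types carry no sort constraint, so truth values, pairs and options
  can occur as intermediate stages.\<close>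

lemma lebesgue_simple_comp:
  assumes F: "lebesgue_simple F"
  shows "lebesgue_simple (\<lambda>t. h (F t))"
proof -
  have "range (\<lambda>t. h (F t)) = h ` range F" by auto
  then have "finite (range (\<lambda>t. h (F t)))"
    using F by (simp add: lebesgue_simple_def)
  moreover have "(\<lambda>t. h (F t)) -` {x} = F -` (h -` {x})" for x by auto
  ultimately show ?thesis
    using lebesgue_simple_vimage[OF F] by (auto simp: lebesgue_simple_def)
qed

lemma lebesgue_simple_comp2:
  assumes "lebesgue_simple F" "lebesgue_simple G"
  shows "lebesgue_simple (\<lambda>t. h (F t) (G t))"
  using lebesgue_simple_comp[OF lebesgue_simple_Pair[OF assms], of "case_prod h"] by simp

lemma lebesgue_simple_indicator:
  assumes "A \<in> sets lebesgue"
  shows "lebesgue_simple (\<lambda>t. t \<in> A)"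
proof -
  have "(\<lambda>t. t \<in> A) -` {x} = (if x then A else - A)" for x by auto
  moreover have "- A \<in> sets lebesgue" using assms by (metis Compl_in_sets_lebesgue)
  ultimately show ?thesis
    using assms by (auto simp: lebesgue_simple_def)
qed

lemma lebesgue_measurable_translate: "(\<lambda>t::real. s + t) \<in> lebesgue \<rightarrow>\<^sub>M lebesgue"
  using lebesgue_affine_measurable[of "\<lambda>_. 1" s] by simp

lemma lebesgue_translate_vimage:
  assumes "A \<in> sets lebesgue"
  shows "(\<lambda>t::real. t + s) -` A \<in> sets lebesgue"
  using measurable_sets[OF lebesgue_measurable_translate assms, of s]
  by (simp add: add.commute)

lemma lebesgue_simple_translate:
  assumes "lebesgue_simple F"
  shows "lebesgue_simple (\<lambda>t. F (t + s))"
proof -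
  have "finite (range (\<lambda>t. F (t + s)))"
    using assms by (auto simp: lebesgue_simple_def intro: finite_subset[of _ "range F"])
  moreover have "(\<lambda>t. F (t + s)) -` {x} = (\<lambda>t. t + s) -` (F -` {x})" for x by auto
  ultimately show ?thesis
    using lebesgue_translate_vimage assms by (auto simp: lebesgue_simple_def)
qed

lemma strongly_measurable_iff:
  "strongly_measurable g \<longleftrightarrow>
     (\<exists>F. (\<forall>n. lebesgue_simple (F n)) \<and> (AE t in lebesgue. (\<lambda>n. F n t) \<longlonglongrightarrow> g t))"
  by (simp add: strongly_measurable_def lebesgue_simple_def)

lemma strongly_measurable_simple:
  "lebesgue_simple F \<Longrightarrow> strongly_measurable F"
  unfolding strongly_measurable_iff by (intro exI[of _ "\<lambda>_. F"]) auto

lemma strongly_measurable_comp2: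
  assumes f: "strongly_measurable f" and g: "strongly_measurable g"
    and h: "continuous_on UNIV (\<lambda>x. h (fst x) (snd x))"
  shows "strongly_measurable (\<lambda>t. h (f t) (g t))"
proof -
  obtain F G where F: "\<And>n. lebesgue_simple (F n)" "AE t in lebesgue. (\<lambda>n. F n t) \<longlonglongrightarrow> f t"
    and G: "\<And>n. lebesgue_simple (G n)" "AE t in lebesgue. (\<lambda>n. G n t) \<longlonglongrightarrow> g t"
    using f g unfolding strongly_measurable_iff by blast
  have "AE t in lebesgue. (\<lambda>n. h (F n t) (G n t)) \<longlonglongrightarrow> h (f t) (g t)"
    using F(2) G(2)
  proof eventually_elim
    case (elim t)
    have "(\<lambda>n. (F n t, G n t)) \<longlonglongrightarrow> (f t, g t)" by (intro tendsto_Pair elim)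
    moreover have "isCont (\<lambda>x. h (fst x) (snd x)) (f t, g t)"
      using h by (simp add: continuous_on_eq_continuous_at)
    ultimately show ?case using isCont_tendsto_compose by fastforce
  qed
  then show ?thesis unfolding strongly_measurable_iff
    using lebesgue_simple_comp2[OF F(1) G(1)] by (intro exI[of _ "\<lambda>n t. h (F n t) (G n t)"]) auto
qed

lemma strongly_measurable_diff:
  assumes "strongly_measurable f" "strongly_measurable g"
  shows "strongly_measurable (\<lambda>t. f t - g t)"
  by (rule strongly_measurable_comp2[OF assms]) (intro continuous_intros)

lemma strongly_measurable_add:
  assumes "strongly_measurable f" "strongly_measurable g"
  shows "strongly_measurable (\<lambda>t. f t + g t)"
  by (rule strongly_measurable_comp2[OF assms]) (intro continuous_intros)

lemma AE_lebesgue_translate: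
  fixes s :: real
  assumes "AE t in lebesgue. P t"
  shows "AE t in lebesgue. P (t + s)"
proof -
  have "distr lebesgue lebesgue (\<lambda>t. s + t) = lebesgue"
    using lebesgue_real_affine[of 1 s] by (simp add: density_1)
  then have "AE x in distr lebesgue lebesgue (\<lambda>t. s + t). P x" using assms by (rule ssubst)
  then have "AE t in lebesgue. P (s + t)"
    by (rule AE_distrD[rotated]) (rule lebesgue_measurable_translate)
  then show ?thesis by (simp add: add.commute)
qed

lemma strongly_measurable_translate:
  assumes "strongly_measurable f"
  shows "strongly_measurable (\<lambda>t. f (t + s))"
proof -
  obtain F where F: "\<And>n. lebesgue_simple (F n)" "AE t in lebesgue. (\<lambda>n. F n t) \<longlonglongrightarrow> f t"
    using assms unfolding strongly_measurable_iff by blast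
  show ?thesis unfolding strongly_measurable_iff
    using lebesgue_simple_translate[OF F(1)] AE_lebesgue_translate[OF F(2)]
    by (intro exI[of _ "\<lambda>n t. F n (t + s)"]) auto
qed

text \<open>The norms of the simple approximants are measurable real functions, and so is their
  \<open>lim\<close>, which is defined at every point. It agrees with the norm of \<open>f\<close>
  only almost everywhere, which is enough because Lebesgue measure is complete.\<close>

lemma strongly_measurable_norm:
  assumes "strongly_measurable f"
  shows "(\<lambda>t. norm (f t)) \<in> borel_measurable lebesgue"
proof -
  obtain F where F: "\<And>n. lebesgue_simple (F n)" "AE t in lebesgue. (\<lambda>n. F n t) \<longlonglongrightarrow> f t"
    using assms unfolding strongly_measurable_iff by blast
  define u where "u = (\<lambda>t. lim (\<lambda>n. norm (F n t)))"
  have "(\<lambda>t. norm (F n t)) \<in> borel_measurable lebesgue" for n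
    by (rule lebesgue_simple_measurable_real[OF lebesgue_simple_comp[OF F(1)]])
  then have "u \<in> borel_measurable lebesgue" unfolding u_def by measurable
  moreover have "AE t in lebesgue. u t = norm (f t)"
    using F(2) by eventually_elim (auto simp: u_def intro!: limI tendsto_norm)
  ultimately show ?thesis by (rule borel_measurable_AE)
qed

text \<open>\<open>q\<close> may have infinite range, so the values outside \<open>A\<close> are
  first collapsed to \<open>None\<close>; what remains has finite range and can be composed with
  anything.\<close>

lemma lebesgue_simple_restrict:
  fixes q :: "real \<Rightarrow> int"
  assumes A: "finite A" and m: "\<And>i. q -` {i} \<in> sets lebesgue"
  shows "lebesgue_simple (\<lambda>t. if q t \<in> A then v (q t) else w)"
proof -
  define f where "f = (\<lambda>t. if q t \<in> A then Some (q t) else None)"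
  have "range f \<subseteq> insert None (Some ` A)" by (auto simp: f_def)
  then have "finite (range f)"
    using A by (metis finite_imageI finite_insert finite_subset)
  moreover have "f -` {x} \<in> sets lebesgue" for x
  proof (cases x)
    case None
    have "f -` {None} = - (\<Union>i\<in>A. q -` {i})" by (auto simp: f_def split: if_splits)
    moreover have "(\<Union>i\<in>A. q -` {i}) \<in> sets lebesgue"
      using A m by (intro sets.finite_UN) auto
    ultimately show ?thesis using None by (metis Compl_in_sets_lebesgue)
  next
    case (Some i)
    have "f -` {Some i} = (if i \<in> A then q -` {i} else {})"
      by (auto simp: f_def split: if_splits)
    then show ?thesis using m Some by auto
  qed
  ultimately have "lebesgue_simple f" by (simp add: lebesgue_simple_def)
  from lebesgue_simple_comp[OF this, of "\<lambda>x. case x of None \<Rightarrow> w | Some i \<Rightarrow> v i"]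
  show ?thesis by (simp add: f_def if_distrib cong: if_cong)
qed

lemma lebesgue_simple_step:
  fixes A :: "int set"
  assumes "finite A"
  shows "lebesgue_simple (\<lambda>t::real. if \<lfloor>c * t\<rfloor> \<in> A then v \<lfloor>c * t\<rfloor> else w)"
proof (rule lebesgue_simple_restrict[OF assms])
  fix i
  have "(\<lambda>t::real. \<lfloor>c * t\<rfloor>) -` {i} \<in> sets borel"
    using measurable_sets[of "\<lambda>t::real. \<lfloor>c * t\<rfloor>" borel "count_space UNIV" "{i}"] by simp
  then show "(\<lambda>t::real. \<lfloor>c * t\<rfloor>) -` {i} \<in> sets lebesgue"
    using sets_completionI_sets sets_lborel by metis
qed

lemma strongly_measurable_continuous:
  fixes f :: "real \<Rightarrow> 'v::real_normed_vector"
  assumes "continuous_on UNIV f"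
  shows "strongly_measurable f"
proof -
  \<comment> \<open>Sampling at the left end points of a grid of mesh \<open>1 / Suc n\<close>. The
    index bound \<open>(Suc n)^2\<close> corresponds to the window from \<open>- Suc n\<close> to
    \<open>Suc n\<close> and makes the range finite.\<close>
  define F where "F = (\<lambda>n (t::real). if \<lfloor>real (Suc n) * t\<rfloor> \<in> {- ((int (Suc n))^2) .. (int (Suc n))^2}
     then f (real_of_int \<lfloor>real (Suc n) * t\<rfloor> / real (Suc n)) else 0)"
  have "lebesgue_simple (F n)" for n
    unfolding F_def by (rule lebesgue_simple_step) auto
  moreover have "(\<lambda>n. F n t) \<longlonglongrightarrow> f t" for t
  proof -
    have ev: "eventually (\<lambda>n. F n t = f (real_of_int \<lfloor>real (Suc n) * t\<rfloor> / real (Suc n))) sequentially"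
    proof (rule eventually_sequentiallyI)
      fix n assume "nat \<lceil>\<bar>t\<bar> + 1\<rceil> \<le> n"
      then have n: "\<bar>t\<bar> + 1 \<le> real (Suc n)" by linarith
      have "\<bar>real (Suc n) * t\<bar> \<le> real (Suc n) * (real (Suc n) - 1)"
        unfolding abs_mult using n by (intro mult_mono) auto
      \<comment> \<open>The spare 1 absorbs the loss from taking the floor in the next
        estimate.\<close>
      then have b: "\<bar>real (Suc n) * t\<bar> \<le> (real (Suc n))^2 - 1"
        by (simp add: algebra_simps power2_eq_square)
      have "\<bar>real_of_int \<lfloor>real (Suc n) * t\<rfloor>\<bar> \<le> (real (Suc n))^2" using b by linarith
      then have "\<bar>\<lfloor>real (Suc n) * t\<rfloor>\<bar> \<le> (int (Suc n))^2"
        by (metis of_int_abs of_int_le_iff of_int_of_nat_eq of_int_power)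
      then show "F n t = f (real_of_int \<lfloor>real (Suc n) * t\<rfloor> / real (Suc n))"
        unfolding F_def by (auto simp: abs_le_iff)
    qed
    have "(\<lambda>n. real_of_int \<lfloor>real (Suc n) * t\<rfloor> / real (Suc n) - t) \<longlonglongrightarrow> 0"
    proof (rule Lim_null_comparison)
      show "eventually (\<lambda>n. norm (real_of_int \<lfloor>real (Suc n) * t\<rfloor> / real (Suc n) - t) \<le> 1 / real (Suc n)) sequentially"
      proof (rule always_eventually, rule allI)
        fix n
        have "real_of_int \<lfloor>real (Suc n) * t\<rfloor> / real (Suc n) - t
          = (real_of_int \<lfloor>real (Suc n) * t\<rfloor> - real (Suc n) * t) / real (Suc n)"
          by (simp add: diff_divide_distrib)
        moreover have "\<bar>real_of_int \<lfloor>real (Suc n) * t\<rfloor> - real (Suc n) * t\<bar> \<le> 1" by linarith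
        ultimately show "norm (real_of_int \<lfloor>real (Suc n) * t\<rfloor> / real (Suc n) - t) \<le> 1 / real (Suc n)"
          by (simp only: real_norm_def abs_divide abs_of_nat) (intro divide_right_mono, auto)
      qed
      show "(\<lambda>n. 1 / real (Suc n)) \<longlonglongrightarrow> 0" by (rule lim_1_over_n[THEN LIMSEQ_Suc])
    qed
    then have "(\<lambda>n. real_of_int \<lfloor>real (Suc n) * t\<rfloor> / real (Suc n)) \<longlonglongrightarrow> t"
      by (simp add: LIM_zero_iff)
    moreover have "isCont f t" using assms by (simp add: continuous_on_eq_continuous_at)
    ultimately have "(\<lambda>n. f (real_of_int \<lfloor>real (Suc n) * t\<rfloor> / real (Suc n))) \<longlonglongrightarrow> f t"
      using isCont_tendsto_compose by blast
    then show ?thesis using ev by (simp add: tendsto_cong)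
  qed
  ultimately show ?thesis unfolding strongly_measurable_iff by (intro exI[of _ F]) auto
qed

section \<open>Local integrals\<close>

text \<open>The sum is at most twice the maximum, and the power of the maximum is one of the two
  powers. This crude bound takes the place of Minkowski's inequality.\<close>

lemma powr_add_le:
  fixes a b :: real
  assumes "0 \<le> a" "0 \<le> b" "0 \<le> p"
  shows "(a + b) powr p \<le> 2 powr p * (a powr p + b powr p)"
proof -
  have "(a + b) powr p \<le> (2 * max a b) powr p"
    using assms by (intro powr_mono2) auto
  also have "\<dots> = 2 powr p * (max a b) powr p"
    using assms by (simp add: powr_mult)
  also have "\<dots> \<le> 2 powr p * (a powr p + b powr p)"
    using assms by (intro mult_left_mono) (auto simp: max_def)
  finally show ?thesis .
qed

lemma lp_int_measurable:
  assumes "strongly_measurable f"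
  shows "(\<lambda>t. ennreal (norm (f t) powr p) * indicator {a<..<b} t) \<in> borel_measurable lebesgue"
proof -
  note [measurable] = strongly_measurable_norm[OF assms]
  have [measurable]: "{a<..<b} \<in> sets lebesgue" by simp
  show ?thesis by measurable
qed

lemma lp_int_mono:
  assumes "\<And>t. a < t \<Longrightarrow> t < b \<Longrightarrow> norm (f t) \<le> norm (g t)" "0 \<le> p"
  shows "lp_int p f a b \<le> lp_int p g a b"
  unfolding lp_int_def using assms
  by (intro nn_integral_mono) (auto simp: indicator_def intro!: ennreal_leI powr_mono2)

lemma lp_int_interval_mono:
  assumes "c \<le> a" "b \<le> d"
  shows "lp_int p f a b \<le> lp_int p f c d"
  unfolding lp_int_def using assms
  by (intro nn_integral_mono) (auto simp: indicator_def)

lemma lp_int_cong_AE: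
  assumes "AE t in lebesgue. norm (f t) = norm (g t)"
  shows "lp_int p f a b = lp_int p g a b"
  unfolding lp_int_def using assms
  by (intro nn_integral_cong_AE) (auto elim: eventually_mono)

lemma lp_int_minus_commute: "lp_int p (\<lambda>t. f t - g t) a b = lp_int p (\<lambda>t. g t - f t) a b"
  by (rule lp_int_cong_AE) (simp add: norm_minus_commute)

lemma lp_int_add_le:
  assumes f: "strongly_measurable f" and g: "strongly_measurable g" and p: "0 \<le> p"
  shows "lp_int p (\<lambda>t. f t + g t) a b \<le> ennreal (2 powr p) * (lp_int p f a b + lp_int p g a b)"
proof -
  note [measurable] = lp_int_measurable[OF f] lp_int_measurable[OF g]
  have "lp_int p (\<lambda>t. f t + g t) a b \<le> (\<integral>\<^sup>+t. ennreal (2 powr p) *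
     (ennreal (norm (f t) powr p) * indicator {a<..<b} t + ennreal (norm (g t) powr p) * indicator {a<..<b} t) \<partial>lebesgue)"
    unfolding lp_int_def
  proof (rule nn_integral_mono)
    fix t
    have "norm (f t + g t) powr p \<le> (norm (f t) + norm (g t)) powr p"
      using p by (intro powr_mono2 norm_triangle_ineq) auto
    also have "\<dots> \<le> 2 powr p * (norm (f t) powr p + norm (g t) powr p)"
      using p by (intro powr_add_le) auto
    finally show "ennreal (norm (f t + g t) powr p) * indicator {a<..<b} t \<le> ennreal (2 powr p) *
       (ennreal (norm (f t) powr p) * indicator {a<..<b} t + ennreal (norm (g t) powr p) * indicator {a<..<b} t)"
      by (auto simp: indicator_def ennreal_plus[symmetric] ennreal_mult[symmetric] simp del: ennreal_plus intro!: ennreal_leI)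
  qed
  also have "\<dots> = ennreal (2 powr p) * (lp_int p f a b + lp_int p g a b)"
    unfolding lp_int_def by (subst nn_integral_cmult) (auto simp: nn_integral_add)
  finally show ?thesis .
qed

lemma lp_int_triangle:
  assumes "strongly_measurable f" "strongly_measurable g" "strongly_measurable h" "0 \<le> p"
  shows "lp_int p (\<lambda>t. f t - h t) a b \<le>
    ennreal (2 powr p) * (lp_int p (\<lambda>t. f t - g t) a b + lp_int p (\<lambda>t. g t - h t) a b)"
  using lp_int_add_le[OF strongly_measurable_diff[OF assms(1,2)] strongly_measurable_diff[OF assms(2,3)] assms(4), of a b]
  by simp

lemma lp_int_split:
  assumes f: "strongly_measurable f" and "a \<le> b" "b \<le> c"
  shows "lp_int p f a c = lp_int p f a b + lp_int p f b c"
proof -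
  note [measurable] = lp_int_measurable[OF f]
  have "{b} \<in> null_sets lebesgue" by (metis negligible_iff_null_sets negligible_sing)
  then have "AE t in lebesgue. t \<notin> {b}" by (rule AE_not_in)
  then have "lp_int p f a c = (\<integral>\<^sup>+t. (ennreal (norm (f t) powr p) * indicator {a<..<b} t
      + ennreal (norm (f t) powr p) * indicator {b<..<c} t) \<partial>lebesgue)"
    unfolding lp_int_def
    by (intro nn_integral_cong_AE, eventually_elim) (use assms in \<open>auto simp: indicator_def\<close>)
  then show ?thesis by (simp add: lp_int_def nn_integral_add)
qed

lemma lp_int_translate:
  assumes f: "strongly_measurable f"
  shows "lp_int p (\<lambda>t. f (t + s)) a b = lp_int p f (a + s) (b + s)"
proof -
  have eq: "distr lebesgue lebesgue (\<lambda>t. s + t) = lebesgue"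
    using lebesgue_real_affine[of 1 s] by (simp add: density_1)
  have "lp_int p f (a + s) (b + s) =
    (\<integral>\<^sup>+t. ennreal (norm (f t) powr p) * indicator {a + s<..<b + s} t \<partial>distr lebesgue lebesgue (\<lambda>t. s + t))"
    unfolding lp_int_def eq ..
  also have "\<dots> = (\<integral>\<^sup>+t. ennreal (norm (f (s + t)) powr p) * indicator {a + s<..<b + s} (s + t) \<partial>lebesgue)"
    by (rule nn_integral_distr[OF lebesgue_measurable_translate]) (simp add: lp_int_measurable[OF f])
  also have "\<dots> = lp_int p (\<lambda>t. f (t + s)) a b"
    unfolding lp_int_def by (intro nn_integral_cong) (auto simp: indicator_def add.commute)
  finally show ?thesis ..
qed

lemma lp_int_sum_cells:
  assumes f: "strongly_measurable f" and "0 \<le> d"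
  shows "(\<Sum>i<n. lp_int p f (a + real i * d) (a + real (Suc i) * d)) = lp_int p f a (a + real n * d)"
proof (induction n)
  case 0
  then show ?case by (simp add: lp_int_def)
next
  case (Suc n)
  have "lp_int p f a (a + real (Suc n) * d) =
      lp_int p f a (a + real n * d) + lp_int p f (a + real n * d) (a + real (Suc n) * d)"
    using assms by (intro lp_int_split) (auto simp: algebra_simps)
  then show ?case using Suc by simp
qed

lemma lp_int_const:
  "lp_int p (\<lambda>_. c) a b = ennreal (norm c powr p) * ennreal (b - a)"
  unfolding lp_int_def by (cases "a \<le> b") (auto simp: nn_integral_cmult_indicator ennreal_neg)

lemma lp_int_bound:
  assumes "\<And>t. a < t \<Longrightarrow> t < b \<Longrightarrow> norm (f t) \<le> M" "0 \<le> p"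
  shows "lp_int p f a b \<le> ennreal (M powr p) * ennreal (b - a)"
proof (cases "a < b")
  case True
  \<comment> \<open>A point of the interval shows that \<open>M\<close> is nonnegative, so
    \<open>M\<close> is its own norm in the comparison with a constant.\<close>
  then have "norm (f ((a + b) / 2)) \<le> M" using assms(1)[of "(a + b) / 2"] by simp
  then have "0 \<le> M" by (rule order_trans[OF norm_ge_zero])
  then show ?thesis using lp_int_mono[of a b f "\<lambda>_. M" p] assms lp_int_const[of p M a b] by simp
next
  case False
  then show ?thesis by (simp add: lp_int_def)
qed

text \<open>Removes the root once and for all: with its consequence for \<open>Lpb_norm\<close>,
  every norm bound becomes a bound on \<open>lp_int\<close> over unit windows, and windows can be
  added.\<close>

lemma lp_norm_on_le_iff:
  assumes "0 < p" "0 \<le> e"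
  shows "lp_norm_on p f a b \<le> ennreal e \<longleftrightarrow> lp_int p f a b \<le> ennreal (e powr p)"
proof (cases "lp_int p f a b")
  case (real r)
  have "r powr (1/p) \<le> e \<longleftrightarrow> r \<le> e powr p"
  proof
    assume "r powr (1/p) \<le> e"
    then have "(r powr (1/p)) powr p \<le> e powr p" using assms by (intro powr_mono2) auto
    then show "r \<le> e powr p" using assms real by (simp add: powr_powr)
  next
    assume "r \<le> e powr p"
    then have "r powr (1/p) \<le> (e powr p) powr (1/p)" using assms real by (intro powr_mono2) auto
    then show "r powr (1/p) \<le> e" using assms real by (simp add: powr_powr)
  qed
  then show ?thesis using real assms by (simp add: lp_norm_on_def)
next
  case top
  then show ?thesis by (simp add: lp_norm_on_def top_unique)
qed

lemma Lpb_norm_le_iff: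
  assumes "0 < p" "0 \<le> e"
  shows "Lpb_norm p f \<le> ennreal e \<longleftrightarrow> (\<forall>s. lp_int p f s (s + 1) \<le> ennreal (e powr p))"
  using assms by (simp add: Lpb_norm_def SUP_le_iff lp_norm_on_le_iff)

lemma lp_int_window_le:
  assumes f: "strongly_measurable f" and "0 < p" "0 \<le> e" "Lpb_norm p f \<le> ennreal e"
  shows "lp_int p f s (s + real n) \<le> ennreal (real n * e powr p)"
proof -
  have "lp_int p f s (s + real n * 1) = (\<Sum>i<n. lp_int p f (s + real i * 1) (s + real (Suc i) * 1))"
    by (rule lp_int_sum_cells[symmetric]) (use f in auto)
  also have "\<dots> \<le> (\<Sum>i<n. ennreal (e powr p))"
  proof (rule sum_mono)
    fix i
    have "s + real (Suc i) * 1 = (s + real i * 1) + 1" by simp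
    then show "lp_int p f (s + real i * 1) (s + real (Suc i) * 1) \<le> ennreal (e powr p)"
      using assms Lpb_norm_le_iff[of p e f] by metis
  qed
  also have "\<dots> = ennreal (real n * e powr p)"
    by (simp add: ennreal_mult ennreal_of_nat_eq_real_of_nat)
  finally show ?thesis by simp
qed

section \<open>Compactness of bounded parts of finite-dimensional subspaces\<close>

lemma closed_if_compact_Int_cball:
  fixes S :: "'a::real_normed_vector set"
  assumes "\<And>M. compact (S \<inter> cball 0 M)"
  shows "closed S"
  unfolding closed_sequential_limits
proof (intro allI impI, elim conjE)
  fix x l assume x: "\<forall>n. x n \<in> S" "x \<longlonglongrightarrow> l"
  then have "bounded (range x)" by (intro convergent_imp_bounded)
  then obtain M where M: "\<And>n. norm (x n) \<le> M" unfolding bounded_iff by auto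
  have "closed (S \<inter> cball 0 M)" using assms compact_imp_closed by blast
  moreover have "\<forall>n. x n \<in> S \<inter> cball 0 M" using x M by auto
  ultimately show "l \<in> S" using x(2) closed_sequentially by blast
qed

text \<open>Induction on the generators. A new vector \<open>b\<close> outside the old span has
  positive distance \<open>d\<close> from it, because the old span is closed by the induction
  hypothesis. This distance bounds the coefficient of \<open>b\<close> in any bounded vector, so the
  bounded part of the new span is a closed piece of a continuous image of a compact product.\<close>

lemma compact_span_Int_cball:
  fixes B :: "'a::real_normed_vector set"
  assumes "finite B"
  shows "compact (span B \<inter> cball 0 M)"
  using assms
proof (induction B arbitrary: M rule: finite_induct)
  case empty
  have "span {} \<inter> cball 0 M = (if 0 \<le> M then {0::'a} else {})" by auto
  then show ?case by simp
next
  case (insert b B)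
  show ?case
  proof (cases "b \<in> span B")
    case True
    then show ?thesis using insert.IH by (simp add: span_redundant)
  next
    case False
    have cl: "closed (span B)" by (rule closed_if_compact_Int_cball) (rule insert.IH)
    have "open (- span B)" using cl by auto
    then obtain d where d: "d > 0" "ball b d \<subseteq> - span B"
      using False unfolding open_contains_ball by blast
    have dist: "d \<le> norm (b - w)" if "w \<in> span B" for w
      using d(2) that by (force simp: dist_norm subset_eq)
    \<comment> \<open>For \<open>x = l *\<^sub>R b + w\<close> with nonzero \<open>l\<close>, the
      norm of \<open>x\<close> is \<open>\<bar>l\<bar>\<close> times the distance of
      \<open>b\<close> from a vector of the old span, hence at least
      \<open>\<bar>l\<bar> * d\<close>.\<close>
    define L where "L = \<bar>M\<bar> / d"
    define T where "T = (\<lambda>(l, w). l *\<^sub>R b + w) ` (cbox (-L) L \<times> (span B \<inter> cball 0 (\<bar>M\<bar> + L * norm b)))"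
    have "compact T" unfolding T_def
    proof (intro compact_continuous_image compact_Times insert.IH compact_cbox)
      show "continuous_on (cbox (- L) L \<times> (span B \<inter> cball 0 (\<bar>M\<bar> + L * norm b))) (\<lambda>(l, w). l *\<^sub>R b + w)"
        unfolding case_prod_beta by (intro continuous_intros)
    qed
    have "span (insert b B) \<inter> cball 0 M = T \<inter> cball 0 M"
    proof
      show "T \<inter> cball 0 M \<subseteq> span (insert b B) \<inter> cball 0 M"
      proof
        fix x assume x: "x \<in> T \<inter> cball 0 M"
        then obtain l w where "x = l *\<^sub>R b + w" "w \<in> span B" unfolding T_def by auto
        moreover have "w \<in> span (insert b B)" if "w \<in> span B"
          using that span_mono[of B "insert b B"] by blast
        moreover have "l *\<^sub>R b \<in> span (insert b B)" by (intro span_scale span_base) simp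
        ultimately show "x \<in> span (insert b B) \<inter> cball 0 M"
          using x span_add by blast
      qed
    next
      show "span (insert b B) \<inter> cball 0 M \<subseteq> T \<inter> cball 0 M"
      proof
        fix x assume x: "x \<in> span (insert b B) \<inter> cball 0 M"
        then obtain l where l: "x - l *\<^sub>R b \<in> span B" using span_breakdown_eq by blast
        define w where "w = x - l *\<^sub>R b"
        have nx: "norm x \<le> \<bar>M\<bar>" using x by auto
        have "\<bar>l\<bar> \<le> L"
        proof (cases "l = 0")
          case True
          then show ?thesis using d by (simp add: L_def)
        next
          case False
          have "- (1 / l) *\<^sub>R w \<in> span B" using l unfolding w_def by (rule span_scale)
          then have "d \<le> norm (b - (- (1 / l) *\<^sub>R w))" by (rule dist)
          also have "b - (- (1 / l) *\<^sub>R w) = (1 / l) *\<^sub>R x"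
            using False by (simp add: w_def scaleR_diff_right)
          finally have "d \<le> norm x / \<bar>l\<bar>" by (simp add: divide_inverse mult.commute)
          then have "\<bar>l\<bar> * d \<le> \<bar>M\<bar>" using False nx by (simp add: field_simps)
          then show ?thesis using d by (simp add: L_def field_simps)
        qed
        moreover have "norm w \<le> \<bar>M\<bar> + L * norm b"
        proof -
          have "norm w \<le> norm x + \<bar>l\<bar> * norm b"
            unfolding w_def using norm_triangle_ineq4[of x "l *\<^sub>R b"] by simp
          also have "\<dots> \<le> \<bar>M\<bar> + L * norm b"
            using nx \<open>\<bar>l\<bar> \<le> L\<close> by (intro add_mono mult_right_mono) auto
          finally show ?thesis .
        qed
        moreover have "x = l *\<^sub>R b + w" by (simp add: w_def)
        ultimately show "x \<in> T \<inter> cball 0 M"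
          using x l unfolding T_def w_def[symmetric]
          by (auto intro!: image_eqI[of _ _ "(l, w)"])
      qed
    qed
    then show ?thesis using \<open>compact T\<close> by (simp add: compact_Int_closed)
  qed
qed

section \<open>Smooth bounded functions, and points where a function is at most about
  average\<close>

lemma smooth_bounded_continuous:
  assumes "smooth_bounded f"
  shows "continuous_on UNIV f"
proof -
  obtain D where "D 0 = f" "\<And>k t. (D k has_vector_derivative D (Suc k) t) (at t)"
    using assms unfolding smooth_bounded_def by blast
  then show ?thesis
    by (metis continuous_at_imp_continuous_on has_vector_derivative_continuous)
qed

lemma smooth_bounded_Lipschitz:
  assumes "smooth_bounded f"
  obtains L where "0 \<le> L" "\<And>x y. norm (f x - f y) \<le> L * \<bar>x - y\<bar>"
proof -
  obtain D where D: "D 0 = f" "\<And>k t. (D k has_vector_derivative D (Suc k) t) (at t)"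
     "\<And>k. bounded (range (D k))"
    using assms unfolding smooth_bounded_def by blast
  obtain L where L: "\<And>t. norm (D 1 t) \<le> L" using D(3)[of 1] unfolding bounded_iff by auto
  have "norm (f x - f y) \<le> L * \<bar>x - y\<bar>" for x y
  proof -
    have "norm (f x - f y) \<le> L * norm (x - y)"
    proof (rule differentiable_bound[of UNIV])
      fix z :: real
      show "(f has_derivative (\<lambda>h. h *\<^sub>R D 1 z)) (at z within UNIV)"
        using D(1) D(2)[of 0 z] by (simp add: has_vector_derivative_def)
      show "onorm (\<lambda>h. h *\<^sub>R D 1 z) \<le> L"
      proof (rule onorm_bound)
        show "0 \<le> L" using L[of 0] by (rule order_trans[OF norm_ge_zero])
        show "norm (h *\<^sub>R D 1 z) \<le> L * norm h" for h
          using mult_right_mono[OF L[of z], of "\<bar>h\<bar>"] by (simp add: mult.commute)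
      qed
    qed auto
    then show ?thesis by simp
  qed
  moreover have "0 \<le> L" using L[of 0] by (rule order_trans[OF norm_ge_zero])
  ultimately show ?thesis using that by blast
qed

lemma smooth_bounded_bounded:
  assumes "smooth_bounded f"
  obtains M where "\<And>t. norm (f t) \<le> M"
proof -
  have "bounded (range f)" using assms unfolding smooth_bounded_def by metis
  then show ?thesis using that unfolding bounded_iff by auto
qed

text \<open>If every point violated the bound, integrating a constant would give that the integral
  exceeds itself by \<open>e\<close>. Thanks to the slack \<open>e\<close>, monotonicity of the
  integral is all that this takes.\<close>

lemma ex_point_le_average:
  assumes fin: "lp_int p f a b < \<infinity>" and "a < b" "0 < e"
  shows "\<exists>t. a < t \<and> t < b \<and>
    ennreal (norm (f t) powr p) * ennreal (b - a) \<le> lp_int p f a b + ennreal e"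
proof (rule ccontr)
  assume contra: "\<not> ?thesis"
  obtain I where I: "lp_int p f a b = ennreal I" "0 \<le> I"
    using fin by (cases "lp_int p f a b") auto
  have "ennreal (I + e) = ennreal ((I + e) / (b - a)) * ennreal (b - a)"
    using I assms by (simp add: ennreal_mult[symmetric])
  also have "\<dots> = (\<integral>\<^sup>+t. ennreal ((I + e) / (b - a)) * indicator {a<..<b} t \<partial>lebesgue)"
    using assms by (simp add: nn_integral_cmult_indicator)
  also have "\<dots> \<le> lp_int p f a b"
    unfolding lp_int_def
  proof (intro nn_integral_mono)
    fix t
    show "ennreal ((I + e) / (b - a)) * indicator {a<..<b} t \<le> ennreal (norm (f t) powr p) * indicator {a<..<b} t"
    proof (cases "a < t \<and> t < b")
      case True
      then have "ennreal I + ennreal e < ennreal (norm (f t) powr p) * ennreal (b - a)"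
        using contra I(1) by (auto simp: not_le)
      then have "ennreal (I + e) < ennreal (norm (f t) powr p * (b - a))"
        using I assms by (simp add: ennreal_mult)
      then have "I + e < norm (f t) powr p * (b - a)"
        using I assms by (subst (asm) ennreal_less_iff) auto
      then have "(I + e) / (b - a) \<le> norm (f t) powr p" using assms by (simp add: field_simps)
      then show ?thesis using True by (auto intro: ennreal_leI)
    qed (auto simp: indicator_def)
  qed
  finally show False using I assms by simp
qed

section \<open>Regular functions are translation compact\<close>

text \<open>The net depends on \<open>g1\<close>, \<open>g2\<close>, \<open>z\<close> and
  \<open>m\<close>, but not on the shift: only the choice of a value for each cell does. The error
  bound is a multiple of \<open>z powr p\<close> whose factor depends on \<open>m\<close> and
  \<open>p\<close> alone, so it can be made small although the number of cells and values grows as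
  \<open>z\<close> shrinks.\<close>

lemma translates_step_net:
  fixes g :: "real \<Rightarrow> 'v::real_normed_vector"
  assumes p: "0 < p" and z: "0 < z"
    and g: "strongly_measurable g"
    and g1: "strongly_measurable g1" "\<And>t. g1 t \<in> span B" "finite B" "Lpb_norm p (\<lambda>t. g t - g1 t) \<le> ennreal z"
    and g2: "smooth_bounded g2" "Lpb_norm p (\<lambda>t. g t - g2 t) \<le> ennreal z"
  shows "\<exists>\<Phi>. finite \<Phi> \<and> (\<forall>\<phi>\<in>\<Phi>. lebesgue_simple \<phi>) \<and>
    (\<forall>s. \<exists>\<phi>\<in>\<Phi>. lp_int p (\<lambda>t. g (t + s) - \<phi> t) (- real m) (real m) \<le>
       ennreal (2 * real m * 2 powr p * (1 + 2 powr p * (3 * 2 powr p + 1)) * z powr p))"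
proof -
  define P where "P = (2::real) powr p"
  define Z where "Z = z powr p"
  have P0: "0 \<le> P" and Z0: "0 < Z" using z by (auto simp: P_def Z_def)
  have g2m: "strongly_measurable g2"
    by (rule strongly_measurable_continuous[OF smooth_bounded_continuous[OF g2(1)]])
  have w2: "lp_int p (\<lambda>t. g t - g2 t) s (s + real n) \<le> ennreal (real n * Z)" for s n
    unfolding Z_def using lp_int_window_le[OF strongly_measurable_diff[OF g g2m]] p z g2(2) by simp
  have w1: "lp_int p (\<lambda>t. g t - g1 t) s (s + real n) \<le> ennreal (real n * Z)" for s n
    unfolding Z_def using lp_int_window_le[OF strongly_measurable_diff[OF g g1(1)]] p z g1(4) by simp
  have w21: "lp_int p (\<lambda>t. g2 t - g1 t) s (s + real n) \<le> ennreal (P * (2 * real n * Z))" for s n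
  proof -
    have "lp_int p (\<lambda>t. g2 t - g1 t) s (s + real n) \<le>
      ennreal P * (lp_int p (\<lambda>t. g2 t - g t) s (s + real n) + lp_int p (\<lambda>t. g t - g1 t) s (s + real n))"
      unfolding P_def by (rule lp_int_triangle[OF g2m g g1(1)]) (use p in simp)
    also have "\<dots> \<le> ennreal P * (ennreal (real n * Z) + ennreal (real n * Z))"
      using w1 w2[unfolded lp_int_minus_commute[of _ g]] by (intro mult_left_mono add_mono) auto
    also have "\<dots> = ennreal (P * (2 * real n * Z))"
      using P0 Z0 by (simp add: ennreal_plus[symmetric] ennreal_mult[symmetric] del: ennreal_plus)
    finally show ?thesis .
  qed
  obtain L where L: "0 \<le> L" "\<And>x y. norm (g2 x - g2 y) \<le> L * \<bar>x - y\<bar>"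
    using smooth_bounded_Lipschitz[OF g2(1)] by blast
  obtain M2 where M2: "\<And>t. norm (g2 t) \<le> M2" using smooth_bounded_bounded[OF g2(1)] by blast
  \<comment> \<open>The mesh \<open>1 / N\<close> is so fine that \<open>g2\<close>, with Lipschitz
    constant \<open>L\<close>, varies by at most \<open>z\<close> on a cell.\<close>
  obtain N :: nat where N: "N > 0" "L / z < real N"
    using reals_Archimedean2[of "max (L / z) 0"] by (metis max_less_iff_conj of_nat_0_less_iff)
  define d where "d = 1 / real N"
  have d: "0 < d" "d \<le> 1" "real N * d = 1" using N by (auto simp: d_def)
  have Ld: "L * d \<le> z" using N z by (simp add: d_def field_simps)
  \<comment> \<open>The cells \<open>[i * d, (i + 1) * d)\<close> with \<open>i\<close> in
    \<open>A\<close> tile the window from \<open>-m\<close> to \<open>m\<close>.\<close>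
  define A where "A = {- int (m * N)..<int (m * N)}"
  \<comment> \<open>A sampled value is a value of \<open>g2\<close> minus one of \<open>H\<close>,
    the difference of the shifted \<open>g2\<close> and \<open>g1\<close>. A cell lies in a unit
    window, where the p-th power integral of \<open>H\<close> is at most \<open>2 * P * Z\<close>;
    the choice of the sample point then bounds \<open>norm H powr p\<close> there by
    \<open>(2 * P * Z + Z) / d\<close>.\<close>
  define M where "M = M2 + ((2 * P * Z + Z) / d) powr (1/p)"
  obtain K where K: "finite K" "span B \<inter> cball 0 M \<subseteq> (\<Union>x\<in>K. ball x z)"
    using compact_span_Int_cball[OF g1(3), of M] z unfolding compact_eq_totally_bounded by blast
  define step where "step = (\<lambda>(c::int \<Rightarrow> 'v) (t::real). if \<lfloor>real N * t\<rfloor> \<in> A then c \<lfloor>real N * t\<rfloor> else 0)"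
  \<comment> \<open>Extensional maps are determined by their values on \<open>A\<close>, so there
    are finitely many of them.\<close>
  define \<Phi> where "\<Phi> = step ` (A \<rightarrow>\<^sub>E K)"
  have "finite \<Phi>" unfolding \<Phi>_def by (intro finite_imageI finite_PiE) (auto simp: A_def K)
  moreover have simple: "lebesgue_simple (step c)" for c
    unfolding step_def by (rule lebesgue_simple_step) (simp add: A_def)
  moreover have "\<exists>\<phi>\<in>\<Phi>. lp_int p (\<lambda>t. g (t + s) - \<phi> t) (- real m) (real m) \<le>
       ennreal (2 * real m * P * (1 + P * (3 * P + 1)) * Z)" for s
  proof -
    have sm: "strongly_measurable (\<lambda>t. g (t + s))" "strongly_measurable (\<lambda>t. g2 (t + s))"
      "strongly_measurable (\<lambda>t. g1 (t + s))"
      using g g2m g1(1) by (auto intro: strongly_measurable_translate)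
    define H where "H = (\<lambda>t. g2 (t + s) - g1 (t + s))"
    define F where "F = (\<lambda>t. g (t + s) - g2 (t + s))"
    have HF: "strongly_measurable H" "strongly_measurable F"
      unfolding H_def F_def using sm by (auto intro: strongly_measurable_diff)
    have Hint: "lp_int p H a (a + real n) \<le> ennreal (P * (2 * real n * Z))" for a n
      unfolding H_def
      using lp_int_translate[OF strongly_measurable_diff[OF g2m g1(1)], of p s a "a + real n"] w21[of "a + s" n]
      by (simp add: algebra_simps)
    have Fint: "lp_int p F a (a + real n) \<le> ennreal (real n * Z)" for a n
      unfolding F_def
      using lp_int_translate[OF strongly_measurable_diff[OF g g2m], of p s a "a + real n"] w2[of "a + s" n]
      by (simp add: algebra_simps)
    define x where "x = (\<lambda>i::int. real_of_int i * d)"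
    have xs: "x (i + 1) = x i + d" for i by (simp add: x_def algebra_simps)
    have cell: "lp_int p H (x i) (x (i + 1)) \<le> ennreal (2 * P * Z)" for i
    proof -
      have "lp_int p H (x i) (x (i + 1)) \<le> lp_int p H (x i) (x i + real 1)"
        unfolding xs using d by (intro lp_int_interval_mono) auto
      also have "\<dots> \<le> ennreal (P * (2 * real 1 * Z))" by (rule Hint)
      finally show ?thesis by (simp add: mult.commute mult.left_commute)
    qed
    have "\<exists>t. x i < t \<and> t < x (i + 1) \<and>
        ennreal (norm (H t) powr p) * ennreal d \<le> lp_int p H (x i) (x (i + 1)) + ennreal (Z * d)" for i
    proof -
      have "lp_int p H (x i) (x (i + 1)) < \<infinity>" using le_less_trans[OF cell ennreal_less_top] by simp
      \<comment> \<open>The slack is proportional to the length of the cell, so that over all cells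
        it adds up to only \<open>2 * real m * Z\<close>.\<close>
      from ex_point_le_average[OF this, of "Z * d"] d Z0 show ?thesis by (simp add: xs)
    qed
    then obtain \<tau> where \<tau>: "\<And>i. x i < \<tau> i" "\<And>i. \<tau> i < x (i + 1)"
      "\<And>i. ennreal (norm (H (\<tau> i)) powr p) * ennreal d \<le> lp_int p H (x i) (x (i + 1)) + ennreal (Z * d)"
      by metis
    \<comment> \<open>The value is taken from \<open>g1\<close>, so it lies in
      \<open>span B\<close>; closeness to \<open>g2\<close> at the same point is what
      \<open>H\<close> measures.\<close>
    define w where "w = (\<lambda>i. g1 (\<tau> i + s))"
    have wM: "w i \<in> span B \<inter> cball 0 M" for i
    proof -
      have "ennreal (norm (H (\<tau> i)) powr p) * ennreal d \<le> ennreal (2 * P * Z) + ennreal (Z * d)"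
        using \<tau>(3)[of i] add_right_mono[OF cell] by (rule order_trans)
      then have "ennreal (norm (H (\<tau> i)) powr p * d) \<le> ennreal (2 * P * Z + Z * d)"
        using d Z0 P0 by (simp add: ennreal_mult)
      then have "norm (H (\<tau> i)) powr p * d \<le> 2 * P * Z + Z * d"
        using d Z0 P0 by (subst (asm) ennreal_le_iff) auto
      also have "\<dots> \<le> 2 * P * Z + Z" using d Z0 by simp
      finally have "norm (H (\<tau> i)) powr p \<le> (2 * P * Z + Z) / d" using d by (simp add: field_simps)
      then have "(norm (H (\<tau> i)) powr p) powr (1/p) \<le> ((2 * P * Z + Z) / d) powr (1/p)"
        using p by (intro powr_mono2) auto
      then have "norm (H (\<tau> i)) \<le> ((2 * P * Z + Z) / d) powr (1/p)"
        using p by (simp add: powr_powr)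
      moreover have "norm (w i) \<le> norm (g2 (\<tau> i + s)) + norm (H (\<tau> i))"
        unfolding w_def H_def using norm_triangle_ineq4[of "g2 (\<tau> i + s)" "g2 (\<tau> i + s) - g1 (\<tau> i + s)"] by simp
      ultimately have "norm (w i) \<le> M" unfolding M_def using M2[of "\<tau> i + s"] by linarith
      then show ?thesis using g1(2) by (simp add: w_def)
    qed
    have "\<exists>k\<in>K. norm (k - w i) < z" for i using wM[of i] K(2) by (force simp: dist_norm)
    then obtain k where k: "\<And>i. k i \<in> K" "\<And>i. norm (k i - w i) < z" by metis
    define \<phi> where "\<phi> = step (restrict k A)"
    have \<phi>m: "strongly_measurable \<phi>" unfolding \<phi>_def by (rule strongly_measurable_simple[OF simple])
    have "\<phi> \<in> \<Phi>" unfolding \<phi>_def \<Phi>_def using k(1) by (intro imageI) auto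
    have fl: "\<lfloor>real N * t\<rfloor> = i" if "x i < t" "t < x (i + 1)" for t i
    proof -
      have "real N * x j = real_of_int j" for j using d(3) by (simp add: x_def algebra_simps)
      then have "real_of_int i < real N * t" "real N * t < real_of_int (i + 1)"
        using that N mult_strict_left_mono[of _ _ "real N"] by (metis of_nat_0_less_iff)+
      then show ?thesis by linarith
    qed
    have cellG: "lp_int p (\<lambda>t. g2 (t + s) - \<phi> t) (x i) (x (i + 1)) \<le>
        ennreal P * (ennreal ((P * Z + Z) * d) + lp_int p H (x i) (x (i + 1)))" if i: "i \<in> A" for i
    proof -
      have "lp_int p (\<lambda>t. g2 (t + s) - \<phi> t) (x i) (x (i + 1)) \<le>
          ennreal ((2 * z + norm (H (\<tau> i))) powr p) * ennreal (x (i + 1) - x i)"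
      proof (rule lp_int_bound)
        fix t assume t: "x i < t" "t < x (i + 1)"
        have "\<phi> t = k i" using fl[OF t] i by (simp add: \<phi>_def step_def)
        moreover have "norm (g2 (t + s) - g2 (\<tau> i + s)) \<le> z"
        proof -
          have "\<bar>(t + s) - (\<tau> i + s)\<bar> \<le> d" using t \<tau>(1,2)[of i] unfolding xs by linarith
          then have "L * \<bar>(t + s) - (\<tau> i + s)\<bar> \<le> L * d" using L(1) by (rule mult_left_mono)
          then show ?thesis using L(2)[of "t + s" "\<tau> i + s"] Ld by linarith
        qed
        moreover have "norm (w i - k i) \<le> z" using k(2)[of i] by (simp add: norm_minus_commute less_imp_le)
        moreover have "norm (g2 (t + s) - k i) \<le>
            norm (g2 (t + s) - g2 (\<tau> i + s)) + norm (w i - k i) + norm (H (\<tau> i))"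
        proof -
          \<comment> \<open>Three errors: oscillation of \<open>g2\<close> on the cell, rounding of
            the sampled value to \<open>K\<close>, and the distance of \<open>g1\<close> from
            \<open>g2\<close> at the sample point. The first two are at most \<open>z\<close>
            each.\<close>
          have "g2 (t + s) - k i = (g2 (t + s) - g2 (\<tau> i + s)) + (w i - k i) + H (\<tau> i)"
            by (simp add: w_def H_def)
          then show ?thesis by (metis add_right_mono norm_triangle_ineq order_trans)
        qed
        ultimately show "norm (g2 (t + s) - \<phi> t) \<le> 2 * z + norm (H (\<tau> i))" by simp
      qed (use p in simp)
      also have "\<dots> \<le> ennreal (P * (P * Z + norm (H (\<tau> i)) powr p)) * ennreal d"
        unfolding xs using powr_add_le[of "2 * z" "norm (H (\<tau> i))" p] z p
        by (intro mult_mono ennreal_leI) (auto simp: P_def Z_def powr_mult)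
      also have "\<dots> = ennreal P * (ennreal (P * Z * d) + ennreal (norm (H (\<tau> i)) powr p) * ennreal d)"
        using P0 Z0 d
        by (simp add: ennreal_mult[symmetric] ennreal_plus[symmetric] algebra_simps del: ennreal_plus)
      also have "\<dots> \<le> ennreal P * (ennreal (P * Z * d) + (lp_int p H (x i) (x (i + 1)) + ennreal (Z * d)))"
        by (intro mult_left_mono add_left_mono \<tau>(3)) auto
      also have "ennreal (P * Z * d) + (lp_int p H (x i) (x (i + 1)) + ennreal (Z * d))
          = ennreal ((P * Z + Z) * d) + lp_int p H (x i) (x (i + 1))"
        using P0 Z0 d by (simp add: distrib_right add.assoc add.commute add.left_commute)
      finally show ?thesis .
    qed
    \<comment> \<open>The cells are renumbered from 0, with offset \<open>m * N\<close>, to match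
      the summation over cells.\<close>
    have grid: "- real m + real j * d = x (int j - int (m * N))"
      "- real m + real (Suc j) * d = x (int j - int (m * N) + 1)" for j
    proof -
      have "real (m * N) * d = real m" using d(3) by simp
      then show "- real m + real j * d = x (int j - int (m * N))"
        "- real m + real (Suc j) * d = x (int j - int (m * N) + 1)"
        by (simp_all add: x_def algebra_simps)
    qed
    define n where "n = 2 * (m * N)"
    have inA: "int j - int (m * N) \<in> A" if "j < n" for j
      using that unfolding A_def n_def atLeastLessThan_iff by linarith
    have end_eq: "- real m + real n * d = real m" using d(3) by (simp add: n_def)
    have nd: "real n * d = 2 * real m" using end_eq by linarith
    have "lp_int p (\<lambda>t. g2 (t + s) - \<phi> t) (- real m) (real m) =
      (\<Sum>j<n. lp_int p (\<lambda>t. g2 (t + s) - \<phi> t) (- real m + real j * d) (- real m + real (Suc j) * d))"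
      using lp_int_sum_cells[OF strongly_measurable_diff[OF sm(2) \<phi>m], of d p "- real m" n] d end_eq by simp
    also have "\<dots> \<le> (\<Sum>j<n. ennreal P * (ennreal ((P * Z + Z) * d) +
       lp_int p H (- real m + real j * d) (- real m + real (Suc j) * d)))"
      unfolding grid(2) unfolding grid(1) by (intro sum_mono cellG inA) simp
    also have "\<dots> = ennreal P * (ennreal (2 * real m * (P * Z + Z)) + lp_int p H (- real m) (real m))"
    proof -
      have "(\<Sum>j<n. ennreal ((P * Z + Z) * d)) = ennreal (real n * ((P * Z + Z) * d))"
        using P0 Z0 d by (simp add: ennreal_mult ennreal_of_nat_eq_real_of_nat)
      also have "real n * ((P * Z + Z) * d) = 2 * real m * (P * Z + Z)"
        using nd by (metis mult.assoc mult.commute)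
      finally show ?thesis
        using lp_int_sum_cells[OF HF(1), of d p "- real m" n] d end_eq
        by (simp add: sum_distrib_left[symmetric] sum.distrib)
    qed
    also have "lp_int p H (- real m) (real m) \<le> ennreal (P * (2 * real (2 * m) * Z))"
      using Hint[of "- real m" "2 * m"] by simp
    finally have G: "lp_int p (\<lambda>t. g2 (t + s) - \<phi> t) (- real m) (real m) \<le>
        ennreal P * (ennreal (2 * real m * (P * Z + Z)) + ennreal (P * (2 * real (2 * m) * Z)))"
      by (simp add: mult_left_mono add_left_mono)
    have "lp_int p (\<lambda>t. g (t + s) - \<phi> t) (- real m) (real m) \<le>
      ennreal P * (lp_int p F (- real m) (real m) + lp_int p (\<lambda>t. g2 (t + s) - \<phi> t) (- real m) (real m))"
      unfolding P_def F_def by (rule lp_int_triangle[OF sm(1) sm(2) \<phi>m]) (use p in simp)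
    also have "\<dots> \<le> ennreal P * (ennreal (real (2 * m) * Z) +
        ennreal P * (ennreal (2 * real m * (P * Z + Z)) + ennreal (P * (2 * real (2 * m) * Z))))"
      using Fint[of "- real m" "2 * m"] G by (intro mult_left_mono add_mono) auto
    \<comment> \<open>Inside the inner bracket, \<open>P + 1\<close> comes from oscillation,
      rounding and slack, and \<open>2 * P\<close> from the integral of \<open>H\<close>; together
      they give \<open>3 * P + 1\<close>. The summand 1 in the outer bracket is the error between
      \<open>g\<close> and \<open>g2\<close>.\<close>
    also have "\<dots> = ennreal (2 * real m * P * (1 + P * (3 * P + 1)) * Z)"
      using P0 Z0
      by (simp add: ennreal_mult[symmetric] ennreal_plus[symmetric] del: ennreal_plus)
        (simp add: algebra_simps)
    finally show ?thesis using \<open>\<phi> \<in> \<Phi>\<close> by blast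
  qed
  ultimately show ?thesis unfolding P_def Z_def \<Phi>_def by blast
qed

section \<open>Almost everywhere limits and extraction of convergent subsequences\<close>

lemma lp_int_Fatou:
  assumes p: "0 < p" and f: "\<And>j. strongly_measurable (f j)"
    and lim: "AE t in lebesgue. (\<lambda>j. f j t) \<longlonglongrightarrow> h t"
    and le: "eventually (\<lambda>j. lp_int p (f j) a b \<le> c) sequentially"
  shows "lp_int p h a b \<le> c"
proof -
  have "lp_int p h a b \<le> (\<integral>\<^sup>+t. liminf (\<lambda>j. ennreal (norm (f j t) powr p) * indicator {a<..<b} t) \<partial>lebesgue)"
    unfolding lp_int_def
  proof (rule nn_integral_mono_AE)
    show "AE t in lebesgue. ennreal (norm (h t) powr p) * indicator {a<..<b} t
      \<le> liminf (\<lambda>j. ennreal (norm (f j t) powr p) * indicator {a<..<b} t)"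
      using lim
    proof eventually_elim
      case (elim t)
      have "(\<lambda>j. norm (f j t) powr p) \<longlonglongrightarrow> norm (h t) powr p"
        using p by (intro tendsto_powr' tendsto_norm elim tendsto_const) auto
      then have "(\<lambda>j. ennreal (norm (f j t) powr p) * indicator {a<..<b} t)
          \<longlonglongrightarrow> ennreal (norm (h t) powr p) * indicator {a<..<b} t"
        by (cases "t \<in> {a<..<b}") auto
      then show ?case by (simp add: lim_imp_Liminf)
    qed
  qed
  also have "\<dots> \<le> liminf (\<lambda>j. lp_int p (f j) a b)"
    unfolding lp_int_def by (rule nn_integral_liminf) (rule lp_int_measurable[OF f])
  also have "\<dots> \<le> limsup (\<lambda>j. lp_int p (f j) a b)"
    by (rule Liminf_le_Limsup) simp
  also have "\<dots> \<le> c" using le by (rule Limsup_bounded)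
  finally show ?thesis .
qed

text \<open>Weighting the increments by \<open>(2 ^ m) powr p\<close> leaves integrals with a
  geometric bound, so the weighted series converges almost everywhere and its terms tend to 0. A
  point belongs to all windows with \<open>m\<close> above its absolute value; from some index on
  its increments are therefore at most \<open>(1/2) ^ m\<close>, and completeness of the space gives
  convergence.\<close>

lemma AE_convergent_if_fast_Cauchy:
  fixes \<phi> :: "nat \<Rightarrow> real \<Rightarrow> 'v::banach"
  assumes p: "0 < p" and \<phi>: "\<And>m. strongly_measurable (\<phi> m)" and C: "0 \<le> C"
    and fast: "\<And>m. lp_int p (\<lambda>t. \<phi> (Suc m) t - \<phi> m t) (- real m) (real m) \<le>
      ennreal (C * (1/2) ^ m / (2 ^ m) powr p)"
  shows "AE t in lebesgue. convergent (\<lambda>m. \<phi> m t)"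
proof -
  define \<Delta> where "\<Delta> = (\<lambda>m t. \<phi> (Suc m) t - \<phi> m t)"
  define u where "u = (\<lambda>m t. (2 ^ m) powr p * norm (\<Delta> m t) powr p * indicator {- real m<..<real m} t)"
  have \<Delta>: "strongly_measurable (\<Delta> m)" for m
    unfolding \<Delta>_def by (intro strongly_measurable_diff \<phi>)
  have u_eq: "ennreal (u m t) = ennreal ((2 ^ m) powr p) *
      (ennreal (norm (\<Delta> m t) powr p) * indicator {- real m<..<real m} t)" for m t
    by (auto simp: u_def indicator_def ennreal_mult)
  have um: "(\<lambda>t. ennreal (u m t)) \<in> borel_measurable lebesgue" for m
    unfolding u_eq by (intro borel_measurable_times_ennreal lp_int_measurable \<Delta>) simp
  have ui: "(\<integral>\<^sup>+t. ennreal (u m t) \<partial>lebesgue) \<le> ennreal (C * (1/2) ^ m)" for m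
  proof -
    have "(\<integral>\<^sup>+t. ennreal (u m t) \<partial>lebesgue) = ennreal ((2 ^ m) powr p) * lp_int p (\<Delta> m) (- real m) (real m)"
      unfolding u_eq lp_int_def by (rule nn_integral_cmult) (rule lp_int_measurable[OF \<Delta>])
    also have "\<dots> \<le> ennreal ((2 ^ m) powr p) * ennreal (C * (1/2) ^ m / (2 ^ m) powr p)"
      unfolding \<Delta>_def by (intro mult_left_mono fast) simp
    also have "\<dots> = ennreal (C * (1/2) ^ m)" using C by (simp add: ennreal_mult[symmetric])
    finally show ?thesis .
  qed
  have "(\<integral>\<^sup>+t. (\<Sum>m. ennreal (u m t)) \<partial>lebesgue) = (\<Sum>m. \<integral>\<^sup>+t. ennreal (u m t) \<partial>lebesgue)"
    by (rule nn_integral_suminf) (rule um)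
  also have "\<dots> \<le> (\<Sum>m. ennreal (C * (1/2) ^ m))" by (intro suminf_le ui summableI)
  also have "\<dots> = ennreal (\<Sum>m. C * (1/2) ^ m)"
    using C by (intro suminf_ennreal2 summable_mult summable_geometric) auto
  finally have "(\<integral>\<^sup>+t. (\<Sum>m. ennreal (u m t)) \<partial>lebesgue) \<noteq> \<infinity>"
    by (auto simp: top_unique)
  then have "AE t in lebesgue. (\<Sum>m. ennreal (u m t)) \<noteq> \<infinity>"
    by (rule nn_integral_PInf_AE[rotated]) (use um in measurable)
  then show ?thesis
  proof eventually_elim
    case (elim t)
    have "summable (\<lambda>m. u m t)"
      using elim by (intro summable_suminf_not_top) (auto simp: u_def)
    then have "(\<lambda>m. u m t) \<longlonglongrightarrow> 0" by (rule summable_LIMSEQ_zero)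
    then have "eventually (\<lambda>m. u m t < 1) sequentially" by (rule order_tendstoD) simp
    moreover have "eventually (\<lambda>m. \<bar>t\<bar> < real m) sequentially"
      by (rule eventually_sequentiallyI[of "nat \<lceil>\<bar>t\<bar>\<rceil> + 1"]) linarith
    ultimately have "eventually (\<lambda>m. norm (\<Delta> m t) \<le> (1/2) ^ m) sequentially"
    proof eventually_elim
      case (elim m)
      then have "t \<in> {- real m<..<real m}" by auto
      with elim have "(2 ^ m * norm (\<Delta> m t)) powr p < 1" by (simp add: u_def powr_mult)
      then have "2 ^ m * norm (\<Delta> m t) < 1"
        using p ge_one_powr_ge_zero[of "2 ^ m * norm (\<Delta> m t)" p] by linarith
      then show ?case by (simp add: power_one_over field_simps)
    qed
    then have "summable (\<lambda>m. \<Delta> m t)"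
      by (rule summable_comparison_test_ev) (rule summable_geometric, simp)
    then have "convergent (\<lambda>n. \<phi> 0 t + (\<Sum>m<n. \<Delta> m t))"
      by (intro convergent_add convergent_const) (simp add: summable_iff_convergent)
    moreover have "\<phi> 0 t + (\<Sum>m<n. \<Delta> m t) = \<phi> n t" for n
      by (simp add: \<Delta>_def sum_lessThan_telescope[of "\<lambda>m. \<phi> m t"])
    ultimately show ?case by simp
  qed
qed

text \<open>By the pigeonhole principle one simple function of each net stays close to infinitely
  many translates. The functions selected along the diagonal form a fast Cauchy sequence, since any
  two of them are close to a common translate.\<close>

lemma translation_compact_if_simple_nets:
  fixes g :: "real \<Rightarrow> 'v::banach"
  assumes p: "0 < p" and g: "Lp_loc p g"
    and net: "\<And>m e. 0 < e \<Longrightarrow> \<exists>\<Phi>. finite \<Phi> \<and> (\<forall>\<phi>\<in>\<Phi>. lebesgue_simple \<phi>) \<and>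
      (\<forall>s. \<exists>\<phi>\<in>\<Phi>. lp_int p (\<lambda>t. g (t + s) - \<phi> t) (- real m) (real m) \<le> ennreal e)"
  shows "translation_compact p g"
  unfolding translation_compact_def
proof
  fix s :: "nat \<Rightarrow> real"
  \<comment> \<open>Exactly the rate that forces almost everywhere convergence of the selected
    simple functions.\<close>
  define e where "e = (\<lambda>m::nat. (1/2) ^ m / (2 ^ m) powr p :: real)"
  have e0: "0 < e m" for m by (simp add: e_def)
  have "(1/2) ^ Suc m \<le> ((1/2) ^ m :: real)" for m by simp
  moreover have "(2 ^ m) powr p \<le> (2 ^ Suc m) powr p" for m using p by (intro powr_mono2) auto
  ultimately have e_Suc: "e (Suc m) \<le> e m" for m unfolding e_def by (intro frac_le) auto
  then have e_mono: "e n \<le> e m" if "m \<le> n" for m n using lift_Suc_antimono_le[of e] that by blast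
  have e_le: "e m \<le> (1/2) ^ m" for m
  proof -
    have "1 \<le> (2 ^ m) powr p" using p by (intro ge_one_powr_ge_zero) auto
    then show ?thesis by (simp add: e_def divide_le_eq mult_le_cancel_left1)
  qed
  have e_lim: "e \<longlonglongrightarrow> 0"
  proof (rule tendsto_sandwich[OF _ _ tendsto_const])
    show "eventually (\<lambda>m. 0 \<le> e m) sequentially" by (intro always_eventually allI less_imp_le e0)
    show "eventually (\<lambda>m. e m \<le> (1/2) ^ m) sequentially" by (intro always_eventually allI e_le)
    show "(\<lambda>m. (1/2) ^ m) \<longlonglongrightarrow> (0 :: real)" by (rule LIMSEQ_realpow_zero) auto
  qed
  have "\<forall>m. \<exists>\<Phi>. finite \<Phi> \<and> (\<forall>\<phi>\<in>\<Phi>. lebesgue_simple \<phi>) \<and>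
      (\<forall>s. \<exists>\<phi>\<in>\<Phi>. lp_int p (\<lambda>t. g (t + s) - \<phi> t) (- real m) (real m) \<le> ennreal (e m))"
    using net[OF e0] by (rule allI)
  from choice[OF this] obtain \<Phi> where \<Phi>: "\<And>m. finite (\<Phi> m)" "\<And>m \<phi>. \<phi> \<in> \<Phi> m \<Longrightarrow> lebesgue_simple \<phi>"
    "\<And>m s. \<exists>\<phi>\<in>\<Phi> m. lp_int p (\<lambda>t. g (t + s) - \<phi> t) (- real m) (real m) \<le> ennreal (e m)"
    by blast
  \<comment> \<open>One element of the net serves all terms of the subsequence, so the property is
    inherited by further subsequences, as the diagonal argument requires.\<close>
  define Q where "Q = (\<lambda>n (r :: nat \<Rightarrow> nat). \<exists>\<phi>\<in>\<Phi> n. \<forall>k.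
     lp_int p (\<lambda>t. g (t + s (r k)) - \<phi> t) (- real n) (real n) \<le> ennreal (e n))"
  interpret subseqs Q
  proof
    fix n and r :: "nat \<Rightarrow> nat" assume "strict_mono r"
    have "\<exists>\<phi>\<in>\<Phi> n. \<not> finite {k \<in> UNIV. lp_int p (\<lambda>t. g (t + s (r k)) - \<phi> t) (- real n) (real n) \<le> ennreal (e n)}"
      using \<Phi>(3) by (intro pigeonhole_infinite_rel[OF infinite_UNIV_nat \<Phi>(1)]) auto
    then obtain \<phi> where \<phi>: "\<phi> \<in> \<Phi> n"
      "infinite {k. lp_int p (\<lambda>t. g (t + s (r k)) - \<phi> t) (- real n) (real n) \<le> ennreal (e n)}"
      by auto
    from infinite_enumerate[OF \<phi>(2)] obtain r' :: "nat \<Rightarrow> nat" where "strict_mono r'"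
      "\<forall>k. r' k \<in> {k. lp_int p (\<lambda>t. g (t + s (r k)) - \<phi> t) (- real n) (real n) \<le> ennreal (e n)}"
      by blast
    then show "\<exists>r'. strict_mono r' \<and> Q n (r \<circ> r')" using \<phi>(1) unfolding Q_def by auto
  qed
  define r where "r = diagseq"
  \<comment> \<open>The diagonal sequence refines the \<open>n\<close>-th subsequence only from
    position \<open>Suc n\<close> on, whence the condition \<open>n < k\<close> below.\<close>
  have "Q n (r \<circ> ((+) (Suc n)))" for n
    unfolding r_def by (rule diagseq_holds) (auto simp: Q_def)
  then obtain \<phi> where \<phi>: "\<And>n. \<phi> n \<in> \<Phi> n"
    "\<And>n k. lp_int p (\<lambda>t. g (t + s (r (Suc n + k))) - \<phi> n t) (- real n) (real n) \<le> ennreal (e n)"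
    unfolding Q_def comp_def by metis
  have near: "lp_int p (\<lambda>t. g (t + s (r k)) - \<phi> n t) (- real n) (real n) \<le> ennreal (e n)" if "n < k" for n k
    using \<phi>(2)[of n "k - Suc n"] that by simp
  have \<phi>s: "lebesgue_simple (\<phi> n)" for n using \<phi>(1) \<Phi>(2) by blast
  have \<phi>m: "strongly_measurable (\<phi> n)" for n using \<phi>s by (rule strongly_measurable_simple)
  have gm: "strongly_measurable (\<lambda>t. g (t + c))" for c
    using g by (auto simp: Lp_loc_def intro: strongly_measurable_translate)
  define C where "C = 2 powr p * 2"
  have C0: "0 \<le> C" by (simp add: C_def)
  have close: "lp_int p (\<lambda>t. \<phi> n t - \<phi> m t) (- real m) (real m) \<le> ennreal (C * e m)" if "m \<le> n" for m n
  proof -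
    \<comment> \<open>The index \<open>Suc n\<close> lies beyond both \<open>n\<close> and
      \<open>m\<close>, so this translate is close to both simple functions.\<close>
    let ?f = "\<lambda>t. g (t + s (r (Suc n)))"
    have "lp_int p (\<lambda>t. ?f t - \<phi> n t) (- real m) (real m) \<le> lp_int p (\<lambda>t. ?f t - \<phi> n t) (- real n) (real n)"
      using that by (intro lp_int_interval_mono) auto
    also have "\<dots> \<le> ennreal (e n)" by (rule near) simp
    also have "\<dots> \<le> ennreal (e m)" using e_mono[OF that] by (rule ennreal_leI)
    finally have 1: "lp_int p (\<lambda>t. \<phi> n t - ?f t) (- real m) (real m) \<le> ennreal (e m)"
      by (simp add: lp_int_minus_commute[of _ "\<phi> n"])
    have 2: "lp_int p (\<lambda>t. ?f t - \<phi> m t) (- real m) (real m) \<le> ennreal (e m)"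
      using that by (intro near) simp
    have "lp_int p (\<lambda>t. \<phi> n t - \<phi> m t) (- real m) (real m) \<le> ennreal (2 powr p) *
      (lp_int p (\<lambda>t. \<phi> n t - ?f t) (- real m) (real m) + lp_int p (\<lambda>t. ?f t - \<phi> m t) (- real m) (real m))"
      by (rule lp_int_triangle[OF \<phi>m gm \<phi>m]) (use p in simp)
    also have "\<dots> \<le> ennreal (2 powr p) * (ennreal (e m) + ennreal (e m))"
      using 1 2 by (intro mult_left_mono add_mono) auto
    also have "\<dots> = ennreal (C * e m)"
      using e0[of m] by (simp add: C_def ennreal_plus[symmetric] ennreal_mult[symmetric] del: ennreal_plus)
    finally show ?thesis .
  qed
  have conv: "AE t in lebesgue. convergent (\<lambda>m. \<phi> m t)"
    by (rule AE_convergent_if_fast_Cauchy[OF p \<phi>m C0]) (use close[of _ "Suc _"] in \<open>simp add: e_def\<close>)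
  define h where "h = (\<lambda>t. lim (\<lambda>m. \<phi> m t))"
  have lim: "AE t in lebesgue. (\<lambda>m. \<phi> m t) \<longlonglongrightarrow> h t"
    using conv by eventually_elim (simp add: h_def convergent_LIMSEQ_iff)
  have hm: "strongly_measurable h" unfolding strongly_measurable_iff using \<phi>s lim by blast
  have lim_close: "lp_int p (\<lambda>t. \<phi> m t - h t) (- real m) (real m) \<le> ennreal (C * e m)" for m
  proof -
    have "lp_int p (\<lambda>t. h t - \<phi> m t) (- real m) (real m) \<le> ennreal (C * e m)"
    \<comment> \<open>The Cauchy estimate is passed to the limit in \<open>n\<close> with
      \<open>m\<close> fixed; it is available for \<open>n \<ge> m\<close>, which is why the bound
      is needed only eventually.\<close>
    proof (rule lp_int_Fatou[OF p, of "\<lambda>n t. \<phi> n t - \<phi> m t"])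
      show "AE t in lebesgue. (\<lambda>n. \<phi> n t - \<phi> m t) \<longlonglongrightarrow> h t - \<phi> m t"
        using lim by eventually_elim (intro tendsto_intros)
      show "eventually (\<lambda>n. lp_int p (\<lambda>t. \<phi> n t - \<phi> m t) (- real m) (real m) \<le> ennreal (C * e m)) sequentially"
        using eventually_ge_at_top[of m] by eventually_elim (rule close)
    qed (intro strongly_measurable_diff \<phi>m)
    then show ?thesis by (simp add: lp_int_minus_commute[of _ h])
  qed
  define C' where "C' = 2 powr p * (1 + C)"
  have main: "lp_int p (\<lambda>t. g (t + s (r k)) - h t) a b \<le> ennreal (C' * e m)"
    if "m < k" "- real m \<le> a" "b \<le> real m" for m k a b
  proof -
    have "lp_int p (\<lambda>t. g (t + s (r k)) - h t) a b \<le> lp_int p (\<lambda>t. g (t + s (r k)) - h t) (- real m) (real m)"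
      using that by (intro lp_int_interval_mono) auto
    also have "\<dots> \<le> ennreal (2 powr p) * (lp_int p (\<lambda>t. g (t + s (r k)) - \<phi> m t) (- real m) (real m) +
        lp_int p (\<lambda>t. \<phi> m t - h t) (- real m) (real m))"
      by (rule lp_int_triangle[OF gm \<phi>m hm]) (use p in simp)
    also have "\<dots> \<le> ennreal (2 powr p) * (ennreal (e m) + ennreal (C * e m))"
      using that by (intro mult_left_mono add_mono near lim_close) auto
    also have "\<dots> = ennreal (C' * e m)"
      using e0[of m] C0
      by (simp add: C'_def ennreal_plus[symmetric] ennreal_mult[symmetric] algebra_simps del: ennreal_plus)
    finally show ?thesis .
  qed
  have window: "\<exists>M. \<forall>m\<ge>M. - real m \<le> a \<and> b \<le> real m" for a b :: real
  proof (intro exI allI impI)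
    fix m assume "nat \<lceil>\<bar>a\<bar> + \<bar>b\<bar>\<rceil> \<le> m"
    then have "\<bar>a\<bar> + \<bar>b\<bar> \<le> real m" by linarith
    then show "- real m \<le> a \<and> b \<le> real m" by linarith
  qed
  have "Lp_loc p h" unfolding Lp_loc_def
  proof (intro conjI allI hm)
    fix a b
    obtain m where m: "- real m \<le> a" "b \<le> real m" using window[of a b] by blast
    let ?f = "\<lambda>t. g (t + s (r (Suc m)))"
    have "lp_int p h a b = lp_int p (\<lambda>t. (h t - ?f t) + ?f t) a b" by simp
    also have "\<dots> \<le> ennreal (2 powr p) * (lp_int p (\<lambda>t. h t - ?f t) a b + lp_int p ?f a b)"
      by (rule lp_int_add_le[OF strongly_measurable_diff[OF hm gm] gm]) (use p in simp)
    also have "\<dots> < \<infinity>"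
    proof -
      have "lp_int p (\<lambda>t. h t - ?f t) a b < \<infinity>"
        unfolding lp_int_minus_commute[of _ h] using main[of m "Suc m", OF _ m] le_less_trans by fastforce
      moreover have "lp_int p ?f a b < \<infinity>"
        using lp_int_translate[of g p "s (r (Suc m))" a b] g by (simp add: Lp_loc_def)
      ultimately show ?thesis by (simp add: ennreal_mult_less_top)
    qed
    finally show "lp_int p h a b < \<infinity>" .
  qed
  moreover have "(\<lambda>k. lp_int p (\<lambda>t. g (t + s (r k)) - h t) a b) \<longlonglongrightarrow> 0" for a b
  proof -
    obtain M where M: "\<And>m. m \<ge> M \<Longrightarrow> - real m \<le> a \<and> b \<le> real m" using window[of a b] by blast
    have "(\<lambda>m. C' * e m) \<longlonglongrightarrow> 0" using e_lim by (rule tendsto_mult_right_zero)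
    then have lim0: "(\<lambda>m. ennreal (C' * e m)) \<longlonglongrightarrow> 0" using tendsto_ennrealI by fastforce
    \<comment> \<open>Choosing \<open>k = Suc m\<close> lets window and accuracy improve along with
      the sequence; the index shift is undone at the end.\<close>
    have le: "eventually (\<lambda>m. lp_int p (\<lambda>t. g (t + s (r (Suc m))) - h t) a b \<le> ennreal (C' * e m)) sequentially"
      using eventually_ge_at_top[of M] by eventually_elim (intro main, use M in auto)
    have "(\<lambda>m. lp_int p (\<lambda>t. g (t + s (r (Suc m))) - h t) a b) \<longlonglongrightarrow> 0"
      by (rule tendsto_sandwich[OF _ le tendsto_const lim0]) simp
    then show ?thesis by (rule LIMSEQ_imp_Suc)
  qed
  ultimately show "\<exists>r h. strict_mono r \<and> Lp_loc p h \<and>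
      (\<forall>a b. (\<lambda>k. lp_int p (\<lambda>t. g (t + s (r k)) - h t) a b) \<longlonglongrightarrow> 0)"
    using subseq_diagseq unfolding r_def by blast
qed

lemma translation_compact_if_regular:
  fixes g :: "real \<Rightarrow> 'v::banach"
  assumes p: "0 < p" and g: "Lp_loc p g" and "space_regular p g" "time_regular p g"
  shows "translation_compact p g"
proof (rule translation_compact_if_simple_nets[OF p g])
  fix m :: nat and e :: real assume e: "0 < e"
  define C where "C = 2 * real m * 2 powr p * (1 + 2 powr p * (3 * 2 powr p + 1))"
  have C: "0 \<le> C" by (simp add: C_def)
  \<comment> \<open>Solves \<open>(C + 1) * z powr p = e\<close>. The added 1 covers the window
    \<open>m = 0\<close>, where \<open>C\<close> vanishes.\<close>
  define z where "z = (e / (C + 1)) powr (1 / p)"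
  have z: "0 < z" using e C by (simp add: z_def)
  have "C * z powr p \<le> e"
  proof -
    have "z powr p = e / (C + 1)" using e C p by (simp add: z_def powr_powr)
    then have "z powr p + C * z powr p = e" using C by (simp add: field_simps)
    moreover have "0 \<le> z powr p" by simp
    ultimately show ?thesis by linarith
  qed
  obtain B g1 where g1: "finite B" "Lp_b p g1" "\<And>t. g1 t \<in> span B" "Lpb_norm p (\<lambda>t. g t - g1 t) \<le> ennreal z"
    using assms(3)[unfolded space_regular_def, rule_format, OF z] by auto
  obtain g2 where g2: "smooth_bounded g2" "Lpb_norm p (\<lambda>t. g t - g2 t) \<le> ennreal z"
    using assms(4)[unfolded time_regular_def, rule_format, OF z] by auto
  have "strongly_measurable g" "strongly_measurable g1" using g g1(2) by (auto simp: Lp_b_def Lp_loc_def)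
  from translates_step_net[OF p z this g1(3) g1(1) g1(4) g2, of m] obtain \<Phi> where \<Phi>:
    "finite \<Phi>" "\<forall>\<phi>\<in>\<Phi>. lebesgue_simple \<phi>"
    "\<And>s. \<exists>\<phi>\<in>\<Phi>. lp_int p (\<lambda>t. g (t + s) - \<phi> t) (- real m) (real m) \<le> ennreal (C * z powr p)"
    unfolding C_def by blast
  moreover have "ennreal (C * z powr p) \<le> ennreal e" using \<open>C * z powr p \<le> e\<close> by (rule ennreal_leI)
  ultimately show "\<exists>\<Phi>. finite \<Phi> \<and> (\<forall>\<phi>\<in>\<Phi>. lebesgue_simple \<phi>) \<and>
      (\<forall>s. \<exists>\<phi>\<in>\<Phi>. lp_int p (\<lambda>t. g (t + s) - \<phi> t) (- real m) (real m) \<le> ennreal e)"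
    by (meson order_trans)
qed

section \<open>Smooth approximation on the unit interval\<close>

lemma poly_times_exp_minus_at_top:
  fixes q :: "real poly"
  shows "((\<lambda>y. poly q y * exp (- y)) \<longlongrightarrow> 0) at_top"
proof -
  have "((\<lambda>y. \<Sum>i\<le>degree q. coeff q i * (y ^ i / exp y)) \<longlongrightarrow> (\<Sum>i\<le>degree q. coeff q i * 0)) at_top"
    by (intro tendsto_sum tendsto_mult_left tendsto_power_div_exp_0)
  then show ?thesis by (simp add: poly_altdef sum_distrib_right exp_minus divide_inverse mult.assoc)
qed

text \<open>Products of these functions serve as bumps; a polynomial prefactor in \<open>1 / x\<close> makes the
  family closed under differentiation.\<close>

definition flat_exp :: "real poly \<Rightarrow> real \<Rightarrow> real" where
  "flat_exp q x = (if x \<le> 0 then 0 else poly q (1 / x) * exp (- (1 / x)))"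

text \<open>With \<open>y = 1 / x\<close>, whose derivative is \<open>- y^2\<close>, the function
  \<open>q(y) * exp (- y)\<close> has derivative
  \<open>y^2 * (q(y) - q'(y)) * exp (- y)\<close>.\<close>

definition flat_exp_deriv :: "real poly \<Rightarrow> real poly" where
  "flat_exp_deriv q = monom 1 2 * (q - pderiv q)"

lemma flat_exp_has_derivative:
  "(flat_exp q has_field_derivative flat_exp (flat_exp_deriv q) x) (at x)"
proof -
  consider "x < 0" | "x > 0" | "x = 0" by linarith
  then show ?thesis
  proof cases
    case 1
    have "((\<lambda>_. 0) has_field_derivative 0) (at x)" by simp
    then have "(flat_exp q has_field_derivative 0) (at x)"
      by (rule has_field_derivative_transform_within_open[of _ _ _ "{..<0}"])
        (use 1 in \<open>auto simp: flat_exp_def\<close>)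
    then show ?thesis using 1 by (simp add: flat_exp_def)
  next
    case 2
    have "((\<lambda>x. poly q (1 / x) * exp (- (1 / x))) has_field_derivative
        poly (flat_exp_deriv q) (1 / x) * exp (- (1 / x))) (at x)"
      using 2 by (auto intro!: derivative_eq_intros DERIV_chain'[OF _ poly_DERIV]
        simp: flat_exp_deriv_def poly_monom power2_eq_square field_simps)
    then have "(flat_exp q has_field_derivative poly (flat_exp_deriv q) (1 / x) * exp (- (1 / x))) (at x)"
      by (rule has_field_derivative_transform_within_open[of _ _ _ "{0<..}"])
        (use 2 in \<open>auto simp: flat_exp_def\<close>)
    then show ?thesis using 2 by (simp add: flat_exp_def)
  next
    case 3
    have "((\<lambda>h. flat_exp q h / h) \<longlongrightarrow> 0) (at 0)"
      unfolding filterlim_at_split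
    proof
      have "eventually (\<lambda>h. flat_exp q h / h = 0) (at_left (0::real))"
        by (rule eventually_at_leftI[of "-1"]) (auto simp: flat_exp_def)
      then show "((\<lambda>h. flat_exp q h / h) \<longlongrightarrow> 0) (at_left 0)" by (rule tendsto_eventually)
    next
      \<comment> \<open>Dividing by \<open>h\<close> multiplies the polynomial in
        \<open>1 / h\<close> by its variable, which is \<open>pCons 0 q\<close>; the exponential
        still dominates.\<close>
      have "((\<lambda>h. poly (pCons 0 q) (inverse h) * exp (- inverse h)) \<longlongrightarrow> 0) (at_right (0::real))"
        by (rule filterlim_compose[OF poly_times_exp_minus_at_top filterlim_inverse_at_top_right])
      moreover have "eventually (\<lambda>h. poly (pCons 0 q) (inverse h) * exp (- inverse h) = flat_exp q h / h) (at_right (0::real))"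
        by (rule eventually_at_rightI[of _ 1]) (auto simp: flat_exp_def divide_inverse)
      ultimately show "((\<lambda>h. flat_exp q h / h) \<longlongrightarrow> 0) (at_right 0)"
        by (rule Lim_transform_eventually)
    qed
    then show ?thesis using 3 by (simp add: has_field_derivative_iff flat_exp_def)
  qed
qed

lemma smooth_if_closed_under_derivative:
  fixes f :: "real \<Rightarrow> 'v::real_normed_vector"
  assumes "f \<in> S" and "\<And>f. f \<in> S \<Longrightarrow> \<exists>f'\<in>S. \<forall>t. (f has_vector_derivative f' t) (at t)"
  obtains D where "D 0 = f" "\<And>k. D k \<in> S" "\<And>k t. (D k has_vector_derivative D (Suc k) t) (at t)"
proof -
  have "\<exists>D. \<forall>k. (D k \<in> S \<and> (k = 0 \<longrightarrow> D k = f)) \<and>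
      (\<forall>t. (D k has_vector_derivative D (Suc k) t) (at t))"
    by (rule dependent_nat_choice) (use assms in blast)+
  then show ?thesis using that by blast
qed

text \<open>Lists of pairs represent finite sums, so that the product rule stays inside the set.\<close>

definition bump_products :: "real \<Rightarrow> real \<Rightarrow> (real \<Rightarrow> real) set" where
  "bump_products c b = range (\<lambda>qs t. \<Sum>(q, r)\<leftarrow>qs. flat_exp q (c * t) * flat_exp r (c * (b - t)))"

lemma bump_products_closed_under_derivative:
  assumes "f \<in> bump_products c b"
  shows "\<exists>f'\<in>bump_products c b. \<forall>t. (f has_vector_derivative f' t) (at t)"
proof -
  define F where "F = (\<lambda>qs t. \<Sum>(q, r)\<leftarrow>qs. flat_exp q (c * t) * flat_exp r (c * (b - t)))"
  have "\<exists>rs. \<forall>t. (F qs has_vector_derivative F rs t) (at t)" for qs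
  proof (induction qs)
    case Nil
    then show ?case by (intro exI[of _ "[]"]) (simp add: F_def)
  next
    case (Cons x qs)
    obtain q r where x: "x = (q, r)" by (cases x)
    from Cons obtain rs where rs: "\<And>t. (F qs has_field_derivative F rs t) (at t)"
      by (auto simp: has_real_derivative_iff_has_vector_derivative)
    have smult: "flat_exp (smult a q) y = a * flat_exp q y" for a q y by (simp add: flat_exp_def)
    have "((\<lambda>t. flat_exp q (c * t)) has_field_derivative flat_exp (flat_exp_deriv q) (c * t) * c) (at t)" for t
      by (rule DERIV_chain2[OF flat_exp_has_derivative]) (auto intro!: derivative_eq_intros)
    moreover have "((\<lambda>t. flat_exp r (c * (b - t))) has_field_derivative
        flat_exp (flat_exp_deriv r) (c * (b - t)) * (- c)) (at t)" for t
      by (rule DERIV_chain2[OF flat_exp_has_derivative]) (auto intro!: derivative_eq_intros)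
    ultimately have prod: "((\<lambda>t. flat_exp q (c * t) * flat_exp r (c * (b - t))) has_field_derivative
        flat_exp q (c * t) * (flat_exp (flat_exp_deriv r) (c * (b - t)) * (- c)) +
        flat_exp (flat_exp_deriv q) (c * t) * c * flat_exp r (c * (b - t))) (at t)" for t
      by (rule DERIV_mult')
    \<comment> \<open>The product rule turns one pair into two; the inner derivatives
      \<open>c\<close> and \<open>- c\<close> are absorbed into the polynomials.\<close>
    have "(F (x # qs) has_field_derivative
       F ((q, smult (- c) (flat_exp_deriv r)) # (smult c (flat_exp_deriv q), r) # rs) t) (at t)" for t
    proof -
      have "F (x # qs) = (\<lambda>t. flat_exp q (c * t) * flat_exp r (c * (b - t)) + F qs t)"
        by (simp add: F_def x fun_eq_iff)
      moreover have "F ((q, smult (- c) (flat_exp_deriv r)) # (smult c (flat_exp_deriv q), r) # rs) t =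
          flat_exp q (c * t) * (flat_exp (flat_exp_deriv r) (c * (b - t)) * (- c)) +
          flat_exp (flat_exp_deriv q) (c * t) * c * flat_exp r (c * (b - t)) + F rs t"
        unfolding F_def list.map sum_list.Cons case_prod_conv smult by (simp only: mult_ac add_ac)
      ultimately show ?thesis using DERIV_add[OF prod[of t] rs[of t]] by simp
    qed
    then show ?case unfolding has_real_derivative_iff_has_vector_derivative by blast
  qed
  then show ?thesis using assms unfolding bump_products_def F_def by fastforce
qed

text \<open>Holds for the whole class and hence for all derivatives of a bump at once.\<close>

lemma bump_products_eq_0:
  assumes "f \<in> bump_products c b" "0 \<le> c" "t \<le> 0 \<or> b \<le> t"
  shows "f t = 0"
proof -
  obtain qs where f: "f = (\<lambda>t. \<Sum>(q, r)\<leftarrow>qs. flat_exp q (c * t) * flat_exp r (c * (b - t)))"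
    using assms(1) unfolding bump_products_def by blast
  have "c * t \<le> 0 \<or> c * (b - t) \<le> 0" using assms by (auto simp: mult_le_0_iff)
  then have z: "flat_exp q (c * t) * flat_exp r (c * (b - t)) = 0" for q r by (auto simp: flat_exp_def)
  show ?thesis unfolding f by (induction qs) (auto simp: z)
qed

text \<open>All derivatives vanish outside the open unit interval, so that shifted copies fit
  together at the integers to every order. Bounds are not recorded, as they follow from continuity
  on the compact interval.\<close>

definition unit_smooth :: "(real \<Rightarrow> 'v::real_normed_vector) \<Rightarrow> bool" where
  "unit_smooth u \<longleftrightarrow> (\<exists>D B. D 0 = u \<and> (\<forall>k t. (D k has_vector_derivative D (Suc k) t) (at t)) \<and>
     (\<forall>k t. t \<le> 0 \<or> 1 \<le> t \<longrightarrow> D k t = 0) \<and> finite B \<and> (\<forall>t. u t \<in> span B))"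

lemma unit_smooth_bump:
  assumes "0 \<le> c" "b \<le> 1"
  shows "unit_smooth (\<lambda>t. (flat_exp 1 (c * t) * flat_exp 1 (c * (b - t))) *\<^sub>R v)"
proof -
  have "(\<lambda>t. flat_exp 1 (c * t) * flat_exp 1 (c * (b - t))) \<in> bump_products c b"
    unfolding bump_products_def by (rule image_eqI[of _ _ "[(1, 1)]"]) auto
  then obtain D where D: "D 0 = (\<lambda>t. flat_exp 1 (c * t) * flat_exp 1 (c * (b - t)))"
    "\<And>k. D k \<in> bump_products c b" "\<And>k t. (D k has_vector_derivative D (Suc k) t) (at t)"
    using smooth_if_closed_under_derivative[OF _ bump_products_closed_under_derivative] by blast
  show ?thesis unfolding unit_smooth_def
  proof (intro exI conjI allI impI)
    show "((\<lambda>t. D k t *\<^sub>R v) has_vector_derivative D (Suc k) t *\<^sub>R v) (at t)" for k t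
      using D(3)[of k t] by (auto intro!: derivative_eq_intros
        simp: has_real_derivative_iff_has_vector_derivative[symmetric])
    show "D k t *\<^sub>R v = 0" if "t \<le> 0 \<or> 1 \<le> t" for k t
      using bump_products_eq_0[OF D(2)] assms that by auto
    show "finite {v}" by simp
    show "(flat_exp 1 (c * t) * flat_exp 1 (c * (b - t))) *\<^sub>R v \<in> span {v}" for t
      by (intro span_scale span_base) simp
  qed (simp add: D(1))
qed

lemma unit_smooth_0: "unit_smooth (\<lambda>_. 0)"
  unfolding unit_smooth_def by (intro exI[of _ "\<lambda>_ _. 0"] exI[of _ "{}"]) auto

lemma unit_smooth_add:
  assumes "unit_smooth u" "unit_smooth v"
  shows "unit_smooth (\<lambda>t. u t + v t)"
proof -
  from assms(1) obtain D B where D: "D 0 = u" "\<forall>k t. (D k has_vector_derivative D (Suc k) t) (at t)"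
    "\<forall>k t. t \<le> 0 \<or> 1 \<le> t \<longrightarrow> D k t = 0" "finite B" "\<forall>t. u t \<in> span B"
    unfolding unit_smooth_def by blast
  from assms(2) obtain D' B' where D': "D' 0 = v" "\<forall>k t. (D' k has_vector_derivative D' (Suc k) t) (at t)"
    "\<forall>k t. t \<le> 0 \<or> 1 \<le> t \<longrightarrow> D' k t = 0" "finite B'" "\<forall>t. v t \<in> span B'"
    unfolding unit_smooth_def by blast
  have "span B \<subseteq> span (B \<union> B')" "span B' \<subseteq> span (B \<union> B')" by (simp_all add: span_mono)
  then have "u t + v t \<in> span (B \<union> B')" for t using D(5) D'(5) by (blast intro: span_add)
  then show ?thesis unfolding unit_smooth_def using D D'
    by (intro exI[of _ "\<lambda>k t. D k t + D' k t"] exI[of _ "B \<union> B'"])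
      (auto intro!: has_vector_derivative_add)
qed

lemma unit_smooth_strongly_measurable:
  assumes "unit_smooth u"
  shows "strongly_measurable u"
proof (rule strongly_measurable_continuous)
  obtain D where "D 0 = u" "\<And>k t. (D k has_vector_derivative D (Suc k) t) (at t)"
    using assms unfolding unit_smooth_def by blast
  then show "continuous_on UNIV u"
    by (metis continuous_at_imp_continuous_on has_vector_derivative_continuous)
qed

section \<open>Density of the smooth functions in the p-th power integral on the unit
  interval\<close>

lemma lp_int_dominated_tendsto_0:
  assumes p: "0 < p" and f: "\<And>n. strongly_measurable (f n)" and w: "strongly_measurable w"
    and fin: "lp_int p w a b < \<infinity>"
    and le: "\<And>n t. norm (f n t) \<le> norm (w t)"
    and lim: "AE t in lebesgue. a < t \<longrightarrow> t < b \<longrightarrow> (\<lambda>n. f n t) \<longlonglongrightarrow> 0"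
  shows "(\<lambda>n. lp_int p (f n) a b) \<longlonglongrightarrow> 0"
proof -
  have "(\<lambda>n. lp_int p (f n) a b) \<longlonglongrightarrow> (\<integral>\<^sup>+(t::real). 0 \<partial>lebesgue)"
    unfolding lp_int_def
  proof (rule nn_integral_dominated_convergence[where u' = "\<lambda>_. 0"
      and u = "\<lambda>n t. ennreal (norm (f n t) powr p) * indicator {a<..<b} t"
      and w = "\<lambda>t. ennreal (norm (w t) powr p) * indicator {a<..<b} t"])
    show "(\<lambda>t. ennreal (norm (f n t) powr p) * indicator {a<..<b} t) \<in> borel_measurable lebesgue" for n
      by (rule lp_int_measurable[OF f])
    show "(\<lambda>t. ennreal (norm (w t) powr p) * indicator {a<..<b} t) \<in> borel_measurable lebesgue"
      by (rule lp_int_measurable[OF w])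
    show "AE t in lebesgue. ennreal (norm (f n t) powr p) * indicator {a<..<b} t
        \<le> ennreal (norm (w t) powr p) * indicator {a<..<b} t" for n
      using le p by (intro AE_I2 mult_right_mono ennreal_leI powr_mono2) auto
    show "(\<integral>\<^sup>+t. ennreal (norm (w t) powr p) * indicator {a<..<b} t \<partial>lebesgue) < \<infinity>"
      using fin by (simp add: lp_int_def)
    show "AE t in lebesgue. (\<lambda>n. ennreal (norm (f n t) powr p) * indicator {a<..<b} t) \<longlonglongrightarrow> 0"
      using lim
    proof eventually_elim
      case (elim t)
      show ?case
      proof (cases "t \<in> {a<..<b}")
        case True
        then have "(\<lambda>n. norm (f n t)) \<longlonglongrightarrow> 0" using elim by (intro tendsto_norm_zero) auto
        then have "(\<lambda>n. norm (f n t) powr p) \<longlonglongrightarrow> 0 powr p"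
          using p by (intro tendsto_powr' tendsto_const) auto
        then show ?thesis using True tendsto_ennrealI by fastforce
      qed simp
    qed
  qed simp
  then show ?thesis by simp
qed

text \<open>The class is closed under sums and limits, which allows it to be enlarged from
  indicators of half-lines to all of \<open>Lp_loc\<close>. Strong measurability is included because
  the triangle inequality asks for it.\<close>

definition unit_approx :: "real \<Rightarrow> (real \<Rightarrow> 'v::real_normed_vector) \<Rightarrow> bool" where
  "unit_approx p f \<longleftrightarrow> strongly_measurable f \<and>
     (\<forall>e>0. \<exists>u. unit_smooth u \<and> lp_int p (\<lambda>t. f t - u t) 0 1 \<le> ennreal e)"

lemma unit_approxI_lim:
  assumes p: "0 < p" and f: "strongly_measurable f" and h: "\<And>n. unit_approx p (h n)"
    and lim: "(\<lambda>n. lp_int p (\<lambda>t. f t - h n t) 0 1) \<longlonglongrightarrow> 0"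
  shows "unit_approx p f"
  unfolding unit_approx_def
proof (intro conjI allI impI f)
  fix e :: real assume e: "0 < e"
  define d where "d = e / (2 * 2 powr p)"
  have d: "0 < d" "2 powr p * (d + d) = e" using e by (auto simp: d_def field_simps)
  have "eventually (\<lambda>n. lp_int p (\<lambda>t. f t - h n t) 0 1 < ennreal d) sequentially"
    using lim d by (intro order_tendstoD) auto
  then obtain n where n: "lp_int p (\<lambda>t. f t - h n t) 0 1 < ennreal d"
    by (auto simp: eventually_sequentially)
  obtain u where u: "unit_smooth u" "lp_int p (\<lambda>t. h n t - u t) 0 1 \<le> ennreal d"
    using h[of n] d(1) unfolding unit_approx_def by blast
  have "lp_int p (\<lambda>t. f t - u t) 0 1 \<le> ennreal (2 powr p) *
      (lp_int p (\<lambda>t. f t - h n t) 0 1 + lp_int p (\<lambda>t. h n t - u t) 0 1)"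
  proof (rule lp_int_triangle[OF f _ unit_smooth_strongly_measurable[OF u(1)]])
    show "strongly_measurable (h n)" using h[of n] by (simp add: unit_approx_def)
  qed (use p in simp)
  also have "\<dots> \<le> ennreal (2 powr p) * (ennreal d + ennreal d)"
    using n u(2) by (intro mult_left_mono add_mono) auto
  also have "\<dots> = ennreal e"
    using d by (simp add: ennreal_plus[symmetric] ennreal_mult[symmetric] del: ennreal_plus)
  finally show "\<exists>u. unit_smooth u \<and> lp_int p (\<lambda>t. f t - u t) 0 1 \<le> ennreal e" using u(1) by blast
qed

lemma unit_approx_smooth:
  assumes "unit_smooth u"
  shows "unit_approx p u"
  unfolding unit_approx_def using assms unit_smooth_strongly_measurable[OF assms]
  by (auto intro!: exI[of _ u] simp: lp_int_def)

lemma unit_approx_add: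
  assumes p: "0 < p" and f: "unit_approx p f" and g: "unit_approx p g"
  shows "unit_approx p (\<lambda>t. f t + g t)"
  unfolding unit_approx_def
proof (intro conjI allI impI)
  have m: "strongly_measurable f" "strongly_measurable g" using f g by (auto simp: unit_approx_def)
  show "strongly_measurable (\<lambda>t. f t + g t)" using m by (rule strongly_measurable_add)
  fix e :: real assume e: "0 < e"
  define d where "d = e / (2 * 2 powr p)"
  have d: "0 < d" "2 powr p * (d + d) = e" using e by (auto simp: d_def field_simps)
  obtain u where u: "unit_smooth u" "lp_int p (\<lambda>t. f t - u t) 0 1 \<le> ennreal d"
    using f d(1) unfolding unit_approx_def by blast
  obtain v where v: "unit_smooth v" "lp_int p (\<lambda>t. g t - v t) 0 1 \<le> ennreal d"
    using g d(1) unfolding unit_approx_def by blast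
  have "lp_int p (\<lambda>t. f t + g t - (u t + v t)) 0 1 = lp_int p (\<lambda>t. (f t - u t) + (g t - v t)) 0 1"
    by (simp add: algebra_simps)
  also have "\<dots> \<le> ennreal (2 powr p) * (lp_int p (\<lambda>t. f t - u t) 0 1 + lp_int p (\<lambda>t. g t - v t) 0 1)"
    by (rule lp_int_add_le[OF strongly_measurable_diff[OF m(1) unit_smooth_strongly_measurable[OF u(1)]]
          strongly_measurable_diff[OF m(2) unit_smooth_strongly_measurable[OF v(1)]]]) (use p in simp)
  also have "\<dots> \<le> ennreal (2 powr p) * (ennreal d + ennreal d)"
    using u(2) v(2) by (intro mult_left_mono add_mono) auto
  also have "\<dots> = ennreal e"
    using d by (simp add: ennreal_plus[symmetric] ennreal_mult[symmetric] del: ennreal_plus)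
  finally show "\<exists>w. unit_smooth w \<and> lp_int p (\<lambda>t. f t + g t - w t) 0 1 \<le> ennreal e"
    using unit_smooth_add[OF u(1) v(1)] by blast
qed

lemma unit_approx_sum:
  assumes "0 < p" "finite I" "\<And>i. i \<in> I \<Longrightarrow> unit_approx p (f i)"
  shows "unit_approx p (\<lambda>t. \<Sum>i\<in>I. f i t)"
  using assms(2,3)
  by (induction I rule: finite_induct)
    (auto intro: unit_approx_add[OF assms(1)] unit_approx_smooth[OF unit_smooth_0])

lemma unit_approx_cong_AE:
  assumes "unit_approx p f" "strongly_measurable g"
    and eq: "AE t in lebesgue. 0 < t \<longrightarrow> t < 1 \<longrightarrow> f t = g t"
  shows "unit_approx p g"
proof -
  have "lp_int p (\<lambda>t. f t - u t) 0 1 = lp_int p (\<lambda>t. g t - u t) 0 1" for u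
    unfolding lp_int_def
    by (intro nn_integral_cong_AE, use eq in eventually_elim) (auto simp: indicator_def)
  then show ?thesis using assms unfolding unit_approx_def by simp
qed

lemma strongly_measurable_indicator:
  assumes "A \<in> sets lebesgue"
  shows "strongly_measurable (\<lambda>t. indicator A t *\<^sub>R v)"
  using strongly_measurable_simple[OF lebesgue_simple_comp[OF lebesgue_simple_indicator[OF assms],
      of "\<lambda>x. if x then v else 0"]]
  by (rule back_subst[of strongly_measurable]) (auto simp: indicator_def)

text \<open>Bumps of steepness \<open>n\<close> tend to 1 strictly between 0 and \<open>b\<close>
  and vanish elsewhere. Within the unit interval convergence to the indicator can fail only at
  \<open>b\<close>, and the constant \<open>v\<close> dominates.\<close>

lemma unit_approx_atMost:
  assumes p: "0 < p"
  shows "unit_approx p (\<lambda>t::real. indicator {..a} t *\<^sub>R v)"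
proof -
  \<comment> \<open>The bumps must vanish from 1 on, and cutting at 1 changes nothing inside the
    unit interval. For \<open>a \<le> 0\<close> all bumps are 0.\<close>
  define b where "b = min a 1"
  define \<beta> where "\<beta> = (\<lambda>(n::nat) t. flat_exp 1 (real n * t) * flat_exp 1 (real n * (b - t)))"
  have fl01: "0 \<le> flat_exp 1 x" "flat_exp 1 x \<le> 1" for x by (auto simp: flat_exp_def)
  have \<beta>01: "0 \<le> \<beta> n t" "\<beta> n t \<le> 1" for n t
    unfolding \<beta>_def using fl01 by (auto intro: mult_le_one)
  have lim1: "(\<lambda>n. flat_exp 1 (real n * x)) \<longlonglongrightarrow> 1" if "0 < x" for x
  proof -
    have "(\<lambda>n. exp (- (inverse x * (1 / real n)))) \<longlonglongrightarrow> exp (- (inverse x * 0))"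
      by (intro tendsto_exp tendsto_minus tendsto_mult tendsto_const lim_1_over_n)
    moreover have "eventually (\<lambda>n. exp (- (inverse x * (1 / real n))) = flat_exp 1 (real n * x)) sequentially"
      using eventually_gt_at_top[of 0]
      by eventually_elim (use that in \<open>auto simp: flat_exp_def field_simps mult_le_0_iff\<close>)
    ultimately show ?thesis by (auto intro: Lim_transform_eventually)
  qed
  have \<beta>lim: "(\<lambda>n. \<beta> n t) \<longlonglongrightarrow> indicator {..a} t" if t: "0 < t" "t < 1" "t \<noteq> b" for t
  proof (cases "t < b")
    case True
    then have "(\<lambda>n. \<beta> n t) \<longlonglongrightarrow> 1 * 1" unfolding \<beta>_def using t by (intro tendsto_mult lim1) auto
    moreover have "t \<le> a" using True by (simp add: b_def)
    ultimately show ?thesis by simp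
  next
    case False
    then have "\<beta> n t = 0" for n by (auto simp: \<beta>_def flat_exp_def mult_le_0_iff)
    moreover have "\<not> t \<le> a" using False t by (auto simp: b_def min_def split: if_splits)
    ultimately show ?thesis by simp
  qed
  have sm: "unit_smooth (\<lambda>t. \<beta> n t *\<^sub>R v)" for n
    unfolding \<beta>_def by (rule unit_smooth_bump) (auto simp: b_def)
  have im: "strongly_measurable (\<lambda>t::real. indicator {..a} t *\<^sub>R v)"
    by (rule strongly_measurable_indicator) simp
  show ?thesis
  proof (rule unit_approxI_lim[OF p im unit_approx_smooth[OF sm]],
      rule lp_int_dominated_tendsto_0[OF p, where w = "\<lambda>_. v"])
    show "strongly_measurable (\<lambda>t. indicator {..a} t *\<^sub>R v - \<beta> n t *\<^sub>R v)" for n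
      by (intro strongly_measurable_diff im unit_smooth_strongly_measurable[OF sm])
    show "strongly_measurable (\<lambda>_. v)" by (rule strongly_measurable_continuous) simp
    show "lp_int p (\<lambda>_. v) 0 1 < \<infinity>" by (simp add: lp_int_const ennreal_mult_less_top)
    show "norm (indicator {..a} t *\<^sub>R v - \<beta> n t *\<^sub>R v) \<le> norm v" for n t
    proof -
      have "\<bar>indicator {..a} t - \<beta> n t\<bar> \<le> 1" using \<beta>01[of n t] by (auto simp: indicator_def abs_le_iff)
      then show ?thesis
        by (simp add: scaleR_diff_left[symmetric] mult_left_le_one_le del: scaleR_diff_left)
    qed
    have "{b} \<in> null_sets lebesgue" by (metis negligible_iff_null_sets negligible_sing)
    then have "AE t in lebesgue. t \<notin> {b}" by (rule AE_not_in)
    then show "AE t in lebesgue. 0 < t \<longrightarrow> t < 1 \<longrightarrow>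
        (\<lambda>n. indicator {..a} t *\<^sub>R v - \<beta> n t *\<^sub>R v) \<longlonglongrightarrow> 0"
    proof eventually_elim
      case (elim t)
      show ?case
      proof (intro impI)
        assume "0 < t" "t < 1"
        then have "(\<lambda>n. indicator {..a} t *\<^sub>R v - \<beta> n t *\<^sub>R v) \<longlonglongrightarrow> indicator {..a} t *\<^sub>R v - indicator {..a} t *\<^sub>R v"
          using elim by (intro tendsto_intros \<beta>lim) auto
        then show "(\<lambda>n. indicator {..a} t *\<^sub>R v - \<beta> n t *\<^sub>R v) \<longlonglongrightarrow> 0" by simp
      qed
    qed
  qed
qed

text \<open>Dynkin's argument: half-lines form an intersection-stable generator, and the sets with
  approximable indicators are closed under complements and disjoint countable unions.\<close>

lemma unit_approx_borel:
  fixes v :: "'v::real_normed_vector"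
  assumes p: "0 < p" and A: "A \<in> sets (borel :: real measure)"
  shows "unit_approx p (\<lambda>t. indicator A t *\<^sub>R v)"
proof -
  have leb: "B \<in> sets lebesgue" if "B \<in> sigma_sets UNIV (range (\<lambda>a::real. {..a}))" for B
  proof -
    have "B \<in> sets borel" using that by (simp add: borel_eq_atMost sets_measure_of)
    then show ?thesis by simp
  qed
  have st: "Int_stable (range (\<lambda>a::real. {..a}))" by (auto simp: Int_stable_def)
  have sub: "range (\<lambda>a::real. {..a}) \<subseteq> Pow UNIV" by simp
  have "A \<in> sigma_sets UNIV (range (\<lambda>a::real. {..a}))"
    using A by (simp add: borel_eq_atMost sets_measure_of)
  \<comment> \<open>The vector is quantified inside the induction because the complement step uses
    the hypothesis for \<open>- v\<close>.\<close>
  with st sub have "\<forall>v::'v. unit_approx p (\<lambda>t. indicator A t *\<^sub>R v)"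
  proof (induction rule: sigma_sets_induct_disjoint)
    case (basic A)
    then show ?case using unit_approx_atMost[OF p] by auto
  next
    case empty
    show ?case using unit_approx_smooth[OF unit_smooth_0] by simp
  next
    case (compl A)
    show ?case
    proof
      fix v :: 'v
      have "unit_approx p (\<lambda>t. indicator {..1} t *\<^sub>R v + indicator A t *\<^sub>R (- v))"
        by (intro unit_approx_add[OF p] unit_approx_atMost[OF p] compl(2)[rule_format])
      moreover have "UNIV - A \<in> sets lebesgue"
        by (intro leb sigma_sets.Compl compl(1))
      ultimately show "unit_approx p (\<lambda>t. indicator (UNIV - A) t *\<^sub>R v)"
        by (rule unit_approx_cong_AE[OF _ strongly_measurable_indicator]) (auto simp: indicator_def)
    qed
  next
    case (union A)
    have Al: "A i \<in> sets lebesgue" for i using union(2) by (intro leb) auto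
    show ?case
    proof
      fix v :: 'v
      \<comment> \<open>By disjointness the indicator of a partial union is a finite sum; the
        partial unions increase to the full union, which dominated convergence handles.\<close>
      define B where "B = (\<lambda>n. \<Union>i<n. A i)"
      have "B n \<in> sets lebesgue" for n unfolding B_def using Al by (intro sets.finite_UN) auto
      have UA: "(\<Union>i. A i) \<in> sets lebesgue" using Al by (intro sets.countable_UN) auto
      have B: "unit_approx p (\<lambda>t. indicator (B n) t *\<^sub>R v)" for n
      proof (induction n)
        case 0
        show ?case using unit_approx_smooth[OF unit_smooth_0] by (simp add: B_def)
      next
        case (Suc n)
        have "A i \<inter> A n = {}" if "i < n" for i
          using that by (intro disjoint_family_onD[OF union(1)]) auto
        then have "B n \<inter> A n = {}" unfolding B_def by blast
        then have "indicator (B (Suc n)) t *\<^sub>R v = indicator (B n) t *\<^sub>R v + indicator (A n) t *\<^sub>R v" for t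
          by (auto simp: B_def lessThan_Suc indicator_def)
        then show ?case using Suc union(3) by (simp add: unit_approx_add[OF p])
      qed
      show "unit_approx p (\<lambda>t. indicator (\<Union>i. A i) t *\<^sub>R v)"
      proof (rule unit_approxI_lim[OF p strongly_measurable_indicator[OF UA] B],
          rule lp_int_dominated_tendsto_0[OF p, where w = "\<lambda>_. v"])
        show "strongly_measurable (\<lambda>t. indicator (\<Union>i. A i) t *\<^sub>R v - indicator (B n) t *\<^sub>R v)" for n
          by (intro strongly_measurable_diff strongly_measurable_indicator UA \<open>B n \<in> sets lebesgue\<close>)
        show "strongly_measurable (\<lambda>_. v)" by (rule strongly_measurable_continuous) simp
        show "lp_int p (\<lambda>_. v) 0 1 < \<infinity>" by (simp add: lp_int_const ennreal_mult_less_top)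
        show "norm (indicator (\<Union>i. A i) t *\<^sub>R v - indicator (B n) t *\<^sub>R v) \<le> norm v" for n t
          by (auto simp: indicator_def)
        show "AE t in lebesgue. 0 < t \<longrightarrow> t < 1 \<longrightarrow>
            (\<lambda>n. indicator (\<Union>i. A i) t *\<^sub>R v - indicator (B n) t *\<^sub>R v) \<longlonglongrightarrow> 0"
        proof (intro AE_I2 impI)
          fix t
          have "(\<lambda>n. indicator (B n) t :: real) \<longlonglongrightarrow> indicator (\<Union>i. A i) t"
            unfolding B_def by (rule LIMSEQ_indicator_UN)
          then have "(\<lambda>n. indicator (\<Union>i. A i) t *\<^sub>R v - indicator (B n) t *\<^sub>R v) \<longlonglongrightarrow>
              indicator (\<Union>i. A i) t *\<^sub>R v - indicator (\<Union>i. A i) t *\<^sub>R v"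
            by (intro tendsto_intros)
          then show "(\<lambda>n. indicator (\<Union>i. A i) t *\<^sub>R v - indicator (B n) t *\<^sub>R v) \<longlonglongrightarrow> 0" by simp
        qed
      qed
    qed
  qed
  then show ?thesis ..
qed

lemma unit_approx_indicator:
  assumes p: "0 < p" and A: "A \<in> sets lebesgue"
  shows "unit_approx p (\<lambda>t. indicator A t *\<^sub>R v)"
proof -
  obtain S N N' where *: "A = S \<union> N" "N \<subseteq> N'" "N' \<in> null_sets lborel" "S \<in> sets lborel"
    using A by (rule sets_completionE)
  have "AE t in lebesgue. t \<notin> N'" using *(3) by (intro AE_completion AE_not_in)
  then have "AE t in lebesgue. 0 < t \<longrightarrow> t < 1 \<longrightarrow> indicator S t *\<^sub>R v = indicator A t *\<^sub>R v"
    by eventually_elim (use * in \<open>auto simp: indicator_def\<close>)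
  then show ?thesis
    using unit_approx_borel[OF p, of S v] strongly_measurable_indicator[OF A, of v] *(4)
    by (auto intro: unit_approx_cong_AE)
qed

lemma unit_approx_simple:
  assumes p: "0 < p" and F: "lebesgue_simple F"
  shows "unit_approx p F"
proof -
  have "unit_approx p (\<lambda>t. \<Sum>x\<in>range F. indicator (F -` {x}) t *\<^sub>R x)"
    using F by (intro unit_approx_sum[OF p] unit_approx_indicator[OF p]) (auto simp: lebesgue_simple_def)
  moreover have "(\<Sum>x\<in>range F. indicator (F -` {x}) t *\<^sub>R x) = F t" for t
  proof -
    have "(\<Sum>x\<in>range F. indicator (F -` {x}) t *\<^sub>R x) = (\<Sum>x\<in>range F. if x = F t then x else 0)"
      by (intro sum.cong) (auto simp: indicator_def)
    also have "\<dots> = F t" using F by (simp add: lebesgue_simple_def sum.delta)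
    finally show ?thesis .
  qed
  ultimately show ?thesis by simp
qed

text \<open>The simple functions from strong measurability converge almost everywhere but need not
  be dominated. They are set to 0 where they exceed twice the norm of \<open>g\<close>, after which
  the error is dominated by \<open>3 *\<^sub>R g\<close>.\<close>

lemma unit_approx_Lp_loc:
  assumes p: "0 < p" and g: "Lp_loc p g"
  shows "unit_approx p g"
proof -
  have gm: "strongly_measurable g" using g by (simp add: Lp_loc_def)
  then obtain F where F: "\<And>n. lebesgue_simple (F n)" "AE t in lebesgue. (\<lambda>n. F n t) \<longlonglongrightarrow> g t"
    unfolding strongly_measurable_iff by blast
  define A where "A = (\<lambda>n. {t. norm (F n t) \<le> 2 * norm (g t)})"
  have A: "A n \<in> sets lebesgue" for n
  proof -
    note [measurable] = strongly_measurable_norm[OF gm]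
      strongly_measurable_norm[OF strongly_measurable_simple[OF F(1)[of n]]]
    have "{t \<in> space lebesgue. norm (F n t) \<le> 2 * norm (g t)} \<in> sets lebesgue" by measurable
    then show ?thesis by (simp add: A_def)
  qed
  define G where "G = (\<lambda>n t. if t \<in> A n then F n t else 0)"
  have G: "lebesgue_simple (G n)" for n
    unfolding G_def using lebesgue_simple_comp2[OF lebesgue_simple_indicator[OF A] F(1), of "\<lambda>b x. if b then x else 0"]
    by simp
  show ?thesis
  proof (rule unit_approxI_lim[OF p gm unit_approx_simple[OF p G]],
      rule lp_int_dominated_tendsto_0[OF p, where w = "\<lambda>t. 3 *\<^sub>R g t"])
    show "strongly_measurable (\<lambda>t. g t - G n t)" for n
      by (intro strongly_measurable_diff gm strongly_measurable_simple G)
    show "strongly_measurable (\<lambda>t. 3 *\<^sub>R g t)"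
      by (rule strongly_measurable_comp2[OF gm gm, of "\<lambda>x y. 3 *\<^sub>R x"]) (intro continuous_intros)
    have "lp_int p (\<lambda>t. 3 *\<^sub>R g t) 0 1 = ennreal (3 powr p) * lp_int p g 0 1"
      unfolding lp_int_def using lp_int_measurable[OF gm]
      by (subst nn_integral_cmult[symmetric]) (auto simp: powr_mult ennreal_mult mult.assoc)
    then show "lp_int p (\<lambda>t. 3 *\<^sub>R g t) 0 1 < \<infinity>"
      using g by (simp add: Lp_loc_def ennreal_mult_less_top)
    show "norm (g t - G n t) \<le> norm (3 *\<^sub>R g t)" for n t
    proof -
      have "norm (G n t) \<le> 2 * norm (g t)" by (simp add: G_def A_def)
      then show ?thesis using norm_triangle_ineq4[of "g t" "G n t"] by simp
    qed
    show "AE t in lebesgue. 0 < t \<longrightarrow> t < 1 \<longrightarrow> (\<lambda>n. g t - G n t) \<longlonglongrightarrow> 0"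
      using F(2)
    proof eventually_elim
      case (elim t)
      have "(\<lambda>n. G n t) \<longlonglongrightarrow> g t"
      proof (cases "g t = 0")
        case True
        \<comment> \<open>At a zero of \<open>g\<close> no strict inequality is available, but there
          the truncation keeps only values that are 0.\<close>
        then have "G n t = 0" for n by (simp add: G_def A_def)
        then show ?thesis using True by simp
      next
        case False
        then have "eventually (\<lambda>n. norm (F n t) < 2 * norm (g t)) sequentially"
          using tendsto_norm[OF elim] by (intro order_tendstoD) auto
        then have "eventually (\<lambda>n. F n t = G n t) sequentially"
          by eventually_elim (simp add: G_def A_def)
        with elim show ?thesis by (rule Lim_transform_eventually)
      qed
      then have "(\<lambda>n. g t - G n t) \<longlonglongrightarrow> g t - g t" by (intro tendsto_intros)
      then show ?case by simp
    qed
  qed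
qed

section \<open>Translation compact functions are regular\<close>

text \<open>Without such a finite set one could choose shifts one by one, each farther than
  \<open>e\<close> from all earlier ones, and no subsequence of these translates could
  converge.\<close>

lemma translation_compact_imp_totally_bounded:
  fixes g :: "real \<Rightarrow> 'v::real_normed_vector"
  assumes p: "0 < p" and g: "Lp_loc p g" and tc: "translation_compact p g" and e: "0 < e"
  shows "\<exists>S. finite S \<and> (\<forall>s. \<exists>s'\<in>S. lp_int p (\<lambda>t. g (t + s) - g (t + s')) a b \<le> ennreal e)"
proof (rule ccontr)
  assume contra: "\<not> ?thesis"
  then have far: "\<exists>s. \<forall>s'\<in>S. ennreal e < lp_int p (\<lambda>t. g (t + s) - g (t + s')) a b" if "finite S" for S
    using that by (meson not_le)
  \<comment> \<open>Each state consists of the set of earlier shifts and the current shift, so that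
    the choice can refer to the whole history. The first shift is arbitrary.\<close>
  have "\<exists>x. \<forall>n::nat. finite (fst (x n)) \<and>
      (fst (x (Suc n)) = insert (snd (x n)) (fst (x n)) \<and>
       (\<forall>s'\<in>fst (x (Suc n)). ennreal e < lp_int p (\<lambda>t. g (t + snd (x (Suc n))) - g (t + s')) a b))"
  proof (rule dependent_nat_choice)
    show "\<exists>x. finite (fst x)" by (rule exI[of _ "({}, undefined)"]) simp
    fix x :: "real set \<times> real" and n :: nat
    assume "finite (fst x)"
    then obtain s where "\<forall>s'\<in>insert (snd x) (fst x). ennreal e < lp_int p (\<lambda>t. g (t + s) - g (t + s')) a b"
      using far[of "insert (snd x) (fst x)"] by auto
    then show "\<exists>y. finite (fst y) \<and> fst y = insert (snd x) (fst x) \<and>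
       (\<forall>s'\<in>fst y. ennreal e < lp_int p (\<lambda>t. g (t + snd y) - g (t + s')) a b)"
      using \<open>finite (fst x)\<close> by (intro exI[of _ "(insert (snd x) (fst x), s)"]) simp
  qed
  then obtain x where x: "\<And>n::nat. fst (x (Suc n)) = insert (snd (x n)) (fst (x n))"
    "\<And>n s'. s' \<in> fst (x (Suc n)) \<Longrightarrow> ennreal e < lp_int p (\<lambda>t. g (t + snd (x (Suc n))) - g (t + s')) a b"
    by blast
  define s where "s = (\<lambda>n. snd (x n))"
  have mem: "s m \<in> fst (x n)" if "m < n" for m n
    using that by (induction n) (auto simp: x(1) s_def less_Suc_eq)
  have sep: "ennreal e < lp_int p (\<lambda>t. g (t + s n) - g (t + s m)) a b" if "m < n" for m n
    using x(2)[of "s m" "n - 1"] mem[OF that] that by (simp add: s_def)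
  from tc[unfolded translation_compact_def, rule_format, of s] obtain r h where r: "strict_mono r"
    and h: "Lp_loc p h" and lim: "\<And>a b. (\<lambda>k. lp_int p (\<lambda>t. g (t + s (r k)) - h t) a b) \<longlonglongrightarrow> 0"
    by blast
  define d where "d = e / (2 * 2 powr p)"
  have d: "0 < d" "2 powr p * (d + d) = e" using e by (auto simp: d_def field_simps)
  have "eventually (\<lambda>k. lp_int p (\<lambda>t. g (t + s (r k)) - h t) a b < ennreal d) sequentially"
    using lim d by (intro order_tendstoD) auto
  then obtain k where k: "\<And>j. j \<ge> k \<Longrightarrow> lp_int p (\<lambda>t. g (t + s (r j)) - h t) a b < ennreal d"
    by (auto simp: eventually_sequentially)
  have m: "strongly_measurable (\<lambda>t. g (t + c))" "strongly_measurable h" for c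
    using g h by (auto simp: Lp_loc_def intro: strongly_measurable_translate)
  have "lp_int p (\<lambda>t. g (t + s (r (Suc k))) - g (t + s (r k))) a b \<le> ennreal (2 powr p) *
     (lp_int p (\<lambda>t. g (t + s (r (Suc k))) - h t) a b + lp_int p (\<lambda>t. h t - g (t + s (r k))) a b)"
    by (rule lp_int_triangle[OF m(1) m(2) m(1)]) (use p in simp)
  also have "\<dots> \<le> ennreal (2 powr p) * (ennreal d + ennreal d)"
    using k[of k] k[of "Suc k"]
    by (intro mult_left_mono add_mono) (auto simp: lp_int_minus_commute[of _ h])
  also have "\<dots> = ennreal e"
    using d by (simp add: ennreal_plus[symmetric] ennreal_mult[symmetric] del: ennreal_plus)
  finally show False using sep[of "r k" "r (Suc k)"] r by (simp add: strict_mono_Suc_iff)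
qed

lemma smooth_bounded_glue:
  fixes D :: "'i \<Rightarrow> nat \<Rightarrow> real \<Rightarrow> 'v::real_normed_vector"
  assumes S: "finite S" "\<And>n. idx n \<in> S"
    and deriv: "\<And>i k t. i \<in> S \<Longrightarrow> (D i k has_vector_derivative D i (Suc k) t) (at t)"
    and zero: "\<And>i k t. i \<in> S \<Longrightarrow> t \<le> 0 \<or> 1 \<le> t \<Longrightarrow> D i k t = 0"
  shows "smooth_bounded (\<lambda>t::real. D (idx \<lfloor>t\<rfloor>) 0 (t - of_int \<lfloor>t\<rfloor>))"
proof -
  define E where "E = (\<lambda>k (t::real). D (idx \<lfloor>t\<rfloor>) k (t - of_int \<lfloor>t\<rfloor>))"
  \<comment> \<open>Near an integer \<open>n\<close> the glued function is the sum of the two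
    adjacent pieces, each of which vanishes where the other is active. On this open interval the
    derivative is taken of the sum, so the integers need no separate treatment.\<close>
  have E_local: "E k t = D (idx (n - 1)) k (t - of_int (n - 1)) + D (idx n) k (t - of_int n)"
    if "of_int (n - 1) < t" "t < of_int (n + 1)" for k n and t :: real
  proof (cases "t < of_int n")
    case True
    then have "\<lfloor>t\<rfloor> = n - 1" using that by (intro floor_unique) auto
    moreover have "D (idx n) k (t - of_int n) = 0" using True S(2) by (intro zero) auto
    ultimately show ?thesis by (simp add: E_def)
  next
    case False
    then have "\<lfloor>t\<rfloor> = n" using that by (intro floor_unique) auto
    moreover have "D (idx (n - 1)) k (t - of_int (n - 1)) = 0" using False S(2) by (intro zero) auto
    ultimately show ?thesis by (simp add: E_def)
  qed
  have "(E k has_vector_derivative E (Suc k) t) (at t)" for k t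
  proof -
    define n where "n = \<lfloor>t\<rfloor>"
    have t: "of_int (n - 1) < t" "t < of_int (n + 1)" unfolding n_def by linarith+
    have shift: "((\<lambda>t. D i k (t - c)) has_vector_derivative D i (Suc k) (t - c)) (at t)" if "i \<in> S" for i c
    proof -
      have "((\<lambda>t. t - c) has_vector_derivative 1) (at t)" by (auto intro!: derivative_eq_intros)
      from vector_diff_chain_at[OF this deriv[OF that]] show ?thesis by (simp add: o_def)
    qed
    have "((\<lambda>t. D (idx (n - 1)) k (t - of_int (n - 1)) + D (idx n) k (t - of_int n))
        has_vector_derivative E (Suc k) t) (at t)"
      unfolding E_local[OF t] by (intro has_vector_derivative_add shift S)
    then show ?thesis
      by (rule has_vector_derivative_transform_within_open[of _ _ _ "{of_int (n - 1)<..<of_int (n + 1)}"])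
        (use t in \<open>auto simp: E_local[of n]\<close>)
  qed
  moreover have "bounded (range (E k))" for k
  proof -
    have "bounded (range (D i k))" if "i \<in> S" for i
    proof -
      have "continuous_on {0..1} (D i k)"
        by (intro continuous_at_imp_continuous_on ballI has_vector_derivative_continuous[OF deriv[OF that]])
      then have "bounded (D i k ` {0..1})"
        by (intro compact_imp_bounded compact_continuous_image) auto
      moreover have "range (D i k) \<subseteq> insert 0 (D i k ` {0..1})"
      proof
        fix y assume "y \<in> range (D i k)"
        then obtain t where "y = D i k t" by blast
        then show "y \<in> insert 0 (D i k ` {0..1})" using zero[OF that, of t k] by (cases "t \<in> {0..1}") auto
      qed
      ultimately show ?thesis by (meson bounded_insert bounded_subset)
    qed
    then have "bounded (\<Union>i\<in>S. range (D i k))" using S(1) by (intro bounded_UN) auto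
    moreover have "range (E k) \<subseteq> (\<Union>i\<in>S. range (D i k))" using S(2) by (auto simp: E_def)
    ultimately show ?thesis by (rule bounded_subset)
  qed
  ultimately show ?thesis unfolding smooth_bounded_def by (intro exI[of _ E]) (auto simp: E_def)
qed

lemma smooth_bounded_Lp_b:
  assumes p: "0 < p" and f: "smooth_bounded f"
  shows "Lp_b p f"
proof -
  obtain M where M: "\<And>t. norm (f t) \<le> M" using smooth_bounded_bounded[OF f] by blast
  then have "0 \<le> M" by (meson norm_ge_zero order_trans)
  have le: "lp_int p f a b \<le> ennreal (M powr p) * ennreal (b - a)" for a b
    using M p by (intro lp_int_bound) auto
  then have "lp_int p f a b < \<infinity>" for a b
    by (rule le_less_trans) (simp add: ennreal_mult_less_top)
  moreover have "strongly_measurable f"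
    by (rule strongly_measurable_continuous[OF smooth_bounded_continuous[OF f]])
  moreover have "Lpb_norm p f \<le> ennreal M"
  proof -
    have "lp_int p f s (s + 1) \<le> ennreal (M powr p)" for s using le[of s "s + 1"] by simp
    then show ?thesis using p \<open>0 \<le> M\<close> by (simp add: Lpb_norm_le_iff)
  qed
  ultimately show ?thesis unfolding Lp_b_def Lp_loc_def using le_less_trans by fastforce
qed

lemma translation_compact_imp_smooth_approx:
  fixes g :: "real \<Rightarrow> 'v::real_normed_vector"
  assumes p: "0 < p" and g: "Lp_loc p g" and tc: "translation_compact p g" and z: "0 < z"
  shows "\<exists>G B. smooth_bounded G \<and> finite B \<and> (\<forall>t. G t \<in> span B) \<and>
    Lpb_norm p (\<lambda>t. g t - G t) \<le> ennreal z"
proof -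
  \<comment> \<open>The unit window \<open>(s, s + 1)\<close> is covered by two integer cells; each
    of them costs \<open>2 powr p\<close> times two errors \<open>e\<close>, and the total is to be
    \<open>z powr p\<close>.\<close>
  define e where "e = z powr p / (4 * 2 powr p)"
  have e: "0 < e" "2 * (2 powr p * (e + e)) = z powr p" using z by (auto simp: e_def field_simps)
  have gm: "strongly_measurable g" using g by (simp add: Lp_loc_def)
  obtain S where S: "finite S" "\<And>s. \<exists>s'\<in>S. lp_int p (\<lambda>t. g (t + s) - g (t + s')) 0 1 \<le> ennreal e"
    using translation_compact_imp_totally_bounded[OF p g tc e(1), of 0 1] by blast
  have "Lp_loc p (\<lambda>t. g (t + s))" for s
    using g by (auto simp: Lp_loc_def lp_int_translate intro: strongly_measurable_translate)
  from unit_approx_Lp_loc[OF p this] e(1)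
  have "\<forall>s. \<exists>u. unit_smooth u \<and> lp_int p (\<lambda>t. g (t + s) - u t) 0 1 \<le> ennreal e"
    unfolding unit_approx_def by blast
  from choice[OF this] obtain u where u: "\<And>s. unit_smooth (u s)"
    "\<And>s. lp_int p (\<lambda>t. g (t + s) - u s t) 0 1 \<le> ennreal e"
    by blast
  \<comment> \<open>Derivatives and spanning set are paired so that a single choice provides
    both.\<close>
  have "\<forall>s. \<exists>DB. fst DB 0 = u s \<and> (\<forall>k t. (fst DB k has_vector_derivative fst DB (Suc k) t) (at t)) \<and>
     (\<forall>k t. t \<le> 0 \<or> 1 \<le> t \<longrightarrow> fst DB k t = 0) \<and> finite (snd DB) \<and> (\<forall>t. u s t \<in> span (snd DB))"
    (is "\<forall>s. ?P s")
  proof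
    fix s
    from u(1)[of s] obtain D B where "D 0 = u s" "\<forall>k t. (D k has_vector_derivative D (Suc k) t) (at t)"
      "\<forall>k t. t \<le> 0 \<or> 1 \<le> t \<longrightarrow> D k t = 0" "finite B" "\<forall>t. u s t \<in> span B"
      unfolding unit_smooth_def by blast
    then show "?P s" by (intro exI[of _ "(D, B)"]) simp
  qed
  from choice[OF this] obtain DB where DB: "\<And>s. fst (DB s) 0 = u s"
    "\<And>s k t. (fst (DB s) k has_vector_derivative fst (DB s) (Suc k) t) (at t)"
    "\<And>s k t. t \<le> 0 \<or> 1 \<le> t \<Longrightarrow> fst (DB s) k t = 0" "\<And>s. finite (snd (DB s))"
    "\<And>s t. u s t \<in> span (snd (DB s))"
    by blast
  have "\<forall>n::int. \<exists>s'. s' \<in> S \<and> lp_int p (\<lambda>t. g (t + of_int n) - g (t + s')) 0 1 \<le> ennreal e"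
    using S(2) by blast
  from choice[OF this] obtain idx where idx: "\<And>n::int. idx n \<in> S"
    "\<And>n. lp_int p (\<lambda>t. g (t + of_int n) - g (t + idx n)) 0 1 \<le> ennreal e"
    by blast
  define G where "G = (\<lambda>t::real. u (idx \<lfloor>t\<rfloor>) (t - of_int \<lfloor>t\<rfloor>))"
  \<comment> \<open>\<open>idx\<close> takes values in the finite set \<open>S\<close>, so the
    spanning sets of the profiles in use have a finite union.\<close>
  define B where "B = (\<Union>s\<in>S. snd (DB s))"
  have G: "smooth_bounded G"
    using smooth_bounded_glue[of S idx "\<lambda>s. fst (DB s)", OF S(1) idx(1) DB(2) DB(3)]
    by (simp add: G_def DB(1))
  have Gm: "strongly_measurable G"
    by (rule strongly_measurable_continuous[OF smooth_bounded_continuous[OF G]])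
  have B: "finite B" unfolding B_def using S(1) DB(4) by auto
  have GB: "G t \<in> span B" for t
  proof -
    have "span (snd (DB (idx \<lfloor>t\<rfloor>))) \<subseteq> span B" unfolding B_def by (intro span_mono) (use idx(1) in blast)
    then show ?thesis unfolding G_def using DB(5) by blast
  qed
  have unit: "lp_int p (\<lambda>t. g t - G t) (of_int n) (of_int n + 1) \<le> ennreal (2 powr p * (e + e))" for n
  proof -
    have "lp_int p (\<lambda>t. g t - G t) (of_int n) (of_int n + 1) = lp_int p (\<lambda>t. g (t + of_int n) - G (t + of_int n)) 0 1"
      using lp_int_translate[OF strongly_measurable_diff[OF gm Gm], of p "of_int n" 0 1] by (simp add: add.commute)
    also have "\<dots> \<le> lp_int p (\<lambda>t. g (t + of_int n) - u (idx n) t) 0 1"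
    proof (rule lp_int_mono)
      fix t :: real assume "0 < t" "t < 1"
      then have "\<lfloor>t + of_int n\<rfloor> = n" by (intro floor_unique) auto
      then show "norm (g (t + of_int n) - G (t + of_int n)) \<le> norm (g (t + of_int n) - u (idx n) t)"
        by (simp add: G_def)
    qed (use p in simp)
    also have "\<dots> \<le> ennreal (2 powr p) * (lp_int p (\<lambda>t. g (t + of_int n) - g (t + idx n)) 0 1 +
        lp_int p (\<lambda>t. g (t + idx n) - u (idx n) t) 0 1)"
      by (rule lp_int_triangle[OF strongly_measurable_translate[OF gm] strongly_measurable_translate[OF gm]
            unit_smooth_strongly_measurable[OF u(1)]]) (use p in simp)
    also have "\<dots> \<le> ennreal (2 powr p) * (ennreal e + ennreal e)"
      by (intro mult_left_mono add_mono idx(2) u(2)) simp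
    also have "\<dots> = ennreal (2 powr p * (e + e))"
      using e by (simp add: ennreal_plus[symmetric] ennreal_mult[symmetric] del: ennreal_plus)
    finally show ?thesis .
  qed
  have "lp_int p (\<lambda>t. g t - G t) s (s + 1) \<le> ennreal (z powr p)" for s
  proof -
    define n where "n = \<lfloor>s\<rfloor>"
    have n: "of_int n \<le> s" "s < of_int n + 1" unfolding n_def by linarith+
    have "lp_int p (\<lambda>t. g t - G t) s (s + 1) \<le> lp_int p (\<lambda>t. g t - G t) (of_int n) (of_int (n + 1) + 1)"
      using n by (intro lp_int_interval_mono) auto
    also have "\<dots> = lp_int p (\<lambda>t. g t - G t) (of_int n) (of_int n + 1) +
        lp_int p (\<lambda>t. g t - G t) (of_int (n + 1)) (of_int (n + 1) + 1)"
      using lp_int_split[OF strongly_measurable_diff[OF gm Gm], of "of_int n" "of_int (n + 1)" "of_int (n + 1) + 1" p]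
      by simp
    also have "\<dots> \<le> ennreal (2 powr p * (e + e)) + ennreal (2 powr p * (e + e))"
      by (intro add_mono unit)
    also have "\<dots> = ennreal (2 * (2 powr p * (e + e)))"
      using e(1) by (simp add: ennreal_plus[symmetric] del: ennreal_plus)
    also have "\<dots> = ennreal (z powr p)" unfolding e(2) ..
    finally show ?thesis .
  qed
  then have "Lpb_norm p (\<lambda>t. g t - G t) \<le> ennreal z" using p z by (simp add: Lpb_norm_le_iff)
  then show ?thesis using G B GB by blast
qed

theorem theorem2p8:
  fixes g :: "real \<Rightarrow> 'v::banach" and p :: real
  assumes "reflexive_space TYPE('v)"
    and "1 < p"
    and "Lp_b p g"
  shows "(space_regular p g \<and> time_regular p g) \<longleftrightarrow> translation_compact p g"
proof
  have p: "0 < p" using assms by simp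
  have g: "Lp_loc p g" using assms by (simp add: Lp_b_def)
  show "translation_compact p g" if "space_regular p g \<and> time_regular p g"
    using translation_compact_if_regular[OF p g] that by blast
  assume tc: "translation_compact p g"
  note approx = translation_compact_imp_smooth_approx[OF p g tc]
  have "space_regular p g" unfolding space_regular_def
  proof (intro allI impI)
    fix \<epsilon> :: real assume "0 < \<epsilon>"
    from approx[OF this] obtain G B where "smooth_bounded G" "finite B" "\<forall>t. G t \<in> span B"
      "Lpb_norm p (\<lambda>t. g t - G t) \<le> ennreal \<epsilon>"
      by blast
    then show "\<exists>W g\<epsilon>. subspace W \<and> (\<exists>B. finite B \<and> W = span B) \<and>
        Lp_b p g\<epsilon> \<and> (\<forall>t. g\<epsilon> t \<in> W) \<and> Lpb_norm p (\<lambda>t. g t - g\<epsilon> t) \<le> ennreal \<epsilon>"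
      using smooth_bounded_Lp_b[OF p] by (intro exI[of _ "span B"] exI[of _ G]) auto
  qed
  moreover have "time_regular p g" unfolding time_regular_def using approx by blast
  ultimately show "space_regular p g \<and> time_regular p g" ..
qed

end
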